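(* There do not exist integers $c,d$ with $cd\neq 0$ such that the quartic trinomial $f(x)=x^4+cx+d\in\mathbb{Z}[x]$ is both monogenic and cyclic.
   Context: A monic polynomial $f(x)\in\mathbb{Z}[x]$ of degree $n$ is called monogenic if $f(x)$ is irreducible over $\mathbb{Q}$ and $\{1,\theta,\theta^2,\ldots,\theta^{n-1}\}$ is a $\mathbb{Z}$-basis for the ring of integers $\mathbb{Z}_K$ of $K=\mathbb{Q}(\theta)$, where $f(\theta)=0$ (equivalently, $\mathbb{Z}_K=\mathbb{Z}[\theta]$). A monic polynomial $f(x)\in\mathbb{Z}[x]$ of degree $n$ that is irreducible over $\mathbb{Q}$ is called cyclic if the Galois group over $\mathbb{Q}$ of $f(x)$ (i.e. of its splitting field) is isomorphic to the cyclic group of order $n$. *)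

theory Defs
  imports
    "HOL-Algebra.Algebra"
    "HOL-Algebra.Algebraic_Closure_Type"
    "HOL-Computational_Algebra.Computational_Algebra"
    Complex_Main
begin

text \<open>
  Number fields are taken inside the complex numbers. The name \<open>irreducible\<close> and several
  polynomial constants exist both in HOL-Algebra and in HOL-Computational_Algebra; the
  latter are meant throughout, hence the qualified names.
\<close>

abbreviation complex_field :: "complex ring" where
  "complex_field \<equiv> ring_of_type_algebra"

definition complex_roots :: "int Polynomial.poly \<Rightarrow> complex set" where
  "complex_roots f = {z. Polynomial.poly (Polynomial.map_poly of_int f) z = 0}"

definition adjoin_rat :: "complex set \<Rightarrow> complex set" where
  "adjoin_rat S = generate_field complex_field (\<rat> \<union> S)"

definition ring_of_integers :: "complex set \<Rightarrow> complex set" where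
  "ring_of_integers K = {z \<in> K. algebraic_int z}"

definition irreducible_over_rat :: "int Polynomial.poly \<Rightarrow> bool" where
  "irreducible_over_rat f \<longleftrightarrow>
     Factorial_Ring.irreducible (Polynomial.map_poly of_int f :: rat Polynomial.poly)"

interpretation int_module: Modules.module "\<lambda>(k::int) (z::complex). of_int k * z"
  by unfold_locales (simp_all add: algebra_simps)

definition int_basis :: "complex set \<Rightarrow> complex set \<Rightarrow> bool" where
  "int_basis B M \<longleftrightarrow> int_module.independent B \<and> int_module.span B = M"

text \<open>
  The choice of the root \<open>\<theta>\<close> below is immaterial, as all roots of an irreducible polynomial are
  conjugate; irreducibility also makes the powers \<open>\<theta> ^ i\<close> for \<open>i < n\<close> pairwise distinct, so
  that nothing is lost by regarding them as a set.
\<close>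

definition monogenic :: "int Polynomial.poly \<Rightarrow> bool" where
  "monogenic f \<longleftrightarrow>
     Polynomial.lead_coeff f = 1 \<and> irreducible_over_rat f \<and>
     (\<exists>\<theta> \<in> complex_roots f.
        int_basis ((\<lambda>i. \<theta> ^ i) ` {..<Polynomial.degree f}) (ring_of_integers (adjoin_rat {\<theta>})))"

definition splitting_field :: "int Polynomial.poly \<Rightarrow> complex set" where
  "splitting_field f = adjoin_rat (complex_roots f)"

text \<open>
  Automorphisms of \<open>K\<close> are represented by functions that are \<open>undefined\<close> outside \<open>K\<close>
  (this is part of the definition of \<open>Bij\<close>), so that each has exactly one representative.
\<close>

definition rat_automorphisms :: "complex set \<Rightarrow> (complex \<Rightarrow> complex) set" where
  "rat_automorphisms K =
     {\<sigma> \<in> Bij K. \<sigma> \<in> ring_iso (complex_field\<lparr>carrier := K\<rparr>) (complex_field\<lparr>carrier := K\<rparr>) \<and>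
                (\<forall>q \<in> \<rat>. \<sigma> q = q)}"

definition Galois_group :: "int Polynomial.poly \<Rightarrow> (complex \<Rightarrow> complex) monoid" where
  "Galois_group f =
     BijGroup (splitting_field f)\<lparr>carrier := rat_automorphisms (splitting_field f)\<rparr>"

definition cyclic_poly :: "int Polynomial.poly \<Rightarrow> bool" where
  "cyclic_poly f \<longleftrightarrow>
     Polynomial.lead_coeff f = 1 \<and> irreducible_over_rat f \<and>
     Galois_group f \<cong> integer_mod_group (Polynomial.degree f)"

end

theory Submission
  imports Defs
begin

text \<open>
  Suppose that \<open>f = x\<^sup>4 + c x + d\<close> is monogenic and cyclic. A generator \<open>\<sigma>\<close> of the Galois group runs
  through the four roots \<open>x, y, z, w\<close> in a cycle. Put \<open>s = x + z\<close>. Since the four roots have sum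
  \<open>0\<close>, \<open>\<sigma>\<close> maps \<open>s\<close> to \<open>y + w = - s\<close>, so \<open>t = s\<^sup>2\<close> is fixed by \<open>\<sigma>\<close>, hence rational. It satisfies
  \<open>t\<^sup>3 - 4 d t = c\<^sup>2\<close> (it is a rational root of a cubic resolvent of \<open>f\<close>), so it is an integer.
  The product \<open>s (x - z) (y - w)\<close> is fixed by \<open>\<sigma>\<close> as well, and its square is \<open>t\<^sup>3 - 4 c\<^sup>2\<close>; as the square
  of a rational number this is nonnegative, and therefore \<open>t > 0\<close>. This reflects the fact that
  the quadratic subfield of a cyclic quartic field is real.

  Expressed in powers of the root \<open>x\<close>, the number \<open>s\<close> becomes
  \<open>B s = - 3 t c + 2 t\<^sup>2 x - 2 c x\<^sup>2 - 4 t x\<^sup>3\<close> with \<open>B = 3 t\<^sup>2 - 4 d = 2 t\<^sup>2 + c\<^sup>2 / t\<close>.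
  Now \<open>s\<close> is an algebraic integer in \<open>\<rat>(x)\<close>, so monogenicity makes all four
  coefficients integers after division by \<open>B\<close>. In particular \<open>B\<close> divides \<open>4 t\<close>.
  But \<open>B > 2 t\<^sup>2\<close>, which leaves only \<open>t = 1\<close> and \<open>B = 2 + c\<^sup>2\<close>, and \<open>2 + c\<^sup>2\<close> does not divide \<open>4\<close> for
  a nonzero integer \<open>c\<close>.

  The Galois group is given as the group of all automorphisms of the splitting field \<open>L\<close>, so the step
  from ``fixed by \<open>\<sigma>\<close>'' to ``rational'' needs the Galois-theoretic fact that the fixed field of this
  group is \<open>\<rat>\<close> (\<open>fixed_field_rational\<close>). Its proof takes a primitive element \<open>g\<close> of \<open>L\<close>
  (\<open>primitive_element\<close>) with minimal polynomial \<open>M\<close>. Every root \<open>g'\<close> of \<open>M\<close> yields an automorphism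
  \<open>h(g) \<mapsto> h(g')\<close> of \<open>L\<close> (\<open>conjugate_roots_automorphism\<close>). If all of these fix \<open>h(g)\<close>, where
  \<open>deg h < deg M\<close>, then \<open>h\<close> takes the same value at the \<open>deg M\<close> distinct roots of \<open>M\<close>, so \<open>h\<close> is constant.

  The action of \<open>\<sigma>\<close> on the roots is a 4-cycle because \<open>\<sigma>\<^sup>2\<close> is not the identity and so moves some root,
  whose orbit then has four elements (\<open>cyclic_quartic_root_cycle\<close>).
\<close>

section \<open>Subfields of the complex numbers and polynomials over them\<close>

text \<open>
  The closure properties are stated with the operations of the type \<open>complex\<close>, so that the
  fields produced by \<open>adjoin_rat\<close> can be used without the record operations of \<open>complex_field\<close>.
\<close>

locale complex_subfield =
  fixes K :: "complex set"
  assumes one_mem: "1 \<in> K"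
    and add_mem: "\<And>x y. x \<in> K \<Longrightarrow> y \<in> K \<Longrightarrow> x + y \<in> K"
    and uminus_mem: "\<And>x. x \<in> K \<Longrightarrow> - x \<in> K"
    and mult_mem: "\<And>x y. x \<in> K \<Longrightarrow> y \<in> K \<Longrightarrow> x * y \<in> K"
    and inverse_mem: "\<And>x. x \<in> K \<Longrightarrow> x \<noteq> 0 \<Longrightarrow> inverse x \<in> K"
begin

lemma zero_mem: "0 \<in> K"
  using add_mem[OF one_mem uminus_mem[OF one_mem]] by simp

lemma diff_mem: "x \<in> K \<Longrightarrow> y \<in> K \<Longrightarrow> x - y \<in> K"
  using add_mem[of x "- y"] uminus_mem[of y] by simp

lemma divide_mem: "x \<in> K \<Longrightarrow> y \<in> K \<Longrightarrow> x / y \<in> K"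
  by (cases "y = 0") (simp_all add: divide_inverse mult_mem inverse_mem zero_mem)

lemma of_nat_mem: "of_nat n \<in> K"
  by (induction n) (simp_all add: zero_mem one_mem add_mem)

lemma of_int_mem: "of_int n \<in> K"
  by (cases n) (auto simp: of_nat_mem intro!: uminus_mem diff_mem one_mem simp del: of_nat_Suc)

lemma Rats_subset: "\<rat> \<subseteq> K"
proof
  fix x :: complex assume "x \<in> \<rat>"
  then obtain a b where "x = of_int a / of_int b" by (auto elim!: Rats_cases')
  then show "x \<in> K" by (simp add: divide_mem of_int_mem)
qed

lemma power_mem: "x \<in> K \<Longrightarrow> x ^ n \<in> K"
  by (induction n) (simp_all add: one_mem mult_mem)

lemma sum_mem: "(\<And>i. i \<in> I \<Longrightarrow> g i \<in> K) \<Longrightarrow> sum g I \<in> K"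
  by (induction I rule: infinite_finite_induct) (simp_all add: zero_mem add_mem)

end

lemma complex_subfield_Rats: "complex_subfield \<rat>"
  by unfold_locales auto

lemma field_complex: "field complex_field"
  by (rule field_from_type_algebra)

lemma complex_field_simps:
  "carrier complex_field = UNIV" "x \<otimes>\<^bsub>complex_field\<^esub> y = x * y"
  "x \<oplus>\<^bsub>complex_field\<^esub> y = x + y" "\<one>\<^bsub>complex_field\<^esub> = 1" "\<zero>\<^bsub>complex_field\<^esub> = 0"
  by (simp_all add: ring_of_type_algebra_def)

lemma complex_field_uminus: "\<ominus>\<^bsub>complex_field\<^esub> x = - x"
proof -
  interpret C: field "complex_field :: complex ring" by (rule field_complex)
  show ?thesis
    by (rule C.minus_equality) (simp_all add: complex_field_simps)
qed

lemma complex_field_inverse: "x \<noteq> 0 \<Longrightarrow> inv\<^bsub>complex_field\<^esub> x = inverse x"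
proof -
  interpret C: field "complex_field :: complex ring" by (rule field_complex)
  assume "x \<noteq> 0"
  then show ?thesis
    by (intro C.inv_unique'[symmetric]) (simp_all add: complex_field_simps)
qed

lemma adjoin_rat_incl: "x \<in> S \<Longrightarrow> x \<in> adjoin_rat S"
  by (simp add: adjoin_rat_def generate_field.incl)

lemma complex_subfield_adjoin_rat: "complex_subfield (adjoin_rat S)"
proof
  show "1 \<in> adjoin_rat S"
    by (simp add: adjoin_rat_def Rats_1 generate_field.incl)
  fix x y assume x: "x \<in> adjoin_rat S"
  show "- x \<in> adjoin_rat S"
    using generate_field.a_inv[of x complex_field] x
    by (simp add: adjoin_rat_def complex_field_uminus)
  show "inverse x \<in> adjoin_rat S" if "x \<noteq> 0"
    using generate_field.m_inv[of x complex_field] x that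
    by (simp add: adjoin_rat_def complex_field_simps complex_field_inverse)
  assume y: "y \<in> adjoin_rat S"
  show "x + y \<in> adjoin_rat S"
    using generate_field.eng_add[of x complex_field _ y] x y
    by (simp add: adjoin_rat_def complex_field_simps)
  show "x * y \<in> adjoin_rat S"
    using generate_field.eng_mult[of x complex_field _ y] x y
    by (simp add: adjoin_rat_def complex_field_simps)
qed

lemma adjoin_rat_minimal:
  assumes "complex_subfield K" "S \<subseteq> K"
  shows "adjoin_rat S \<subseteq> K"
proof
  interpret complex_subfield K by fact
  fix x assume "x \<in> adjoin_rat S"
  then have "x \<in> generate_field complex_field (\<rat> \<union> S)" by (simp add: adjoin_rat_def)
  then show "x \<in> K"
    by induction
      (use assms(2) Rats_subset in \<open>auto simp: complex_field_simps complex_field_uminus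
         complex_field_inverse intro: one_mem add_mem uminus_mem mult_mem inverse_mem\<close>)
qed

text \<open>
  Polynomials over a subfield are kept as complex polynomials with restricted coefficients, so that they
  can be evaluated at any complex number and compared across different subfields without a change of type.
\<close>

definition poly_over :: "complex set \<Rightarrow> complex poly set" where
  "poly_over K = {p. \<forall>i. Polynomial.coeff p i \<in> K}"

context complex_subfield
begin

lemma poly_over_0: "0 \<in> poly_over K"
  by (simp add: poly_over_def zero_mem)

lemma poly_over_add: "p \<in> poly_over K \<Longrightarrow> q \<in> poly_over K \<Longrightarrow> p + q \<in> poly_over K"
  by (simp add: poly_over_def add_mem)

lemma poly_over_diff: "p \<in> poly_over K \<Longrightarrow> q \<in> poly_over K \<Longrightarrow> p - q \<in> poly_over K"
  by (simp add: poly_over_def diff_mem)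

lemma poly_over_mult: "p \<in> poly_over K \<Longrightarrow> q \<in> poly_over K \<Longrightarrow> p * q \<in> poly_over K"
  by (simp add: poly_over_def coeff_mult sum_mem mult_mem)

lemma poly_over_pCons: "a \<in> K \<Longrightarrow> p \<in> poly_over K \<Longrightarrow> pCons a p \<in> poly_over K"
  by (simp add: poly_over_def coeff_pCons split: nat.split)

lemma poly_over_monom: "a \<in> K \<Longrightarrow> Polynomial.monom a n \<in> poly_over K"
  by (simp add: poly_over_def zero_mem)

lemma poly_over_pderiv: "p \<in> poly_over K \<Longrightarrow> pderiv p \<in> poly_over K"
  by (simp add: poly_over_def coeff_pderiv mult_mem add_mem one_mem of_nat_mem)

lemma poly_over_pcompose: "p \<in> poly_over K \<Longrightarrow> q \<in> poly_over K \<Longrightarrow> pcompose p q \<in> poly_over K"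
proof (induction p)
  case (pCons a p)
  have "a \<in> K" "p \<in> poly_over K"
    using pCons.prems(1) by (auto simp: poly_over_def coeff_pCons split: nat.splits)
  then show ?case
    using pCons by (simp add: pcompose_pCons poly_over_add poly_over_mult poly_over_pCons poly_over_0)
qed (simp add: poly_over_0)

lemma poly_mem: "p \<in> poly_over K \<Longrightarrow> x \<in> K \<Longrightarrow> poly p x \<in> K"
  by (simp add: poly_over_def poly_altdef sum_mem mult_mem power_mem)

text \<open>
  Division with remainder does not leave the subfield: the usual algorithm, cancelling leading terms,
  only divides by the leading coefficient of the divisor.
\<close>

lemma poly_over_division:
  assumes "p \<in> poly_over K" "q \<in> poly_over K" "q \<noteq> 0"
  obtains s r where "s \<in> poly_over K" "r \<in> poly_over K" "p = s * q + r"
    "r = 0 \<or> Polynomial.degree r < Polynomial.degree q"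
proof -
  have "\<exists>s r. s \<in> poly_over K \<and> r \<in> poly_over K \<and> p = s * q + r \<and>
    (r = 0 \<or> Polynomial.degree r < Polynomial.degree q)"
    using assms(1)
  proof (induction "Polynomial.degree p" arbitrary: p rule: less_induct)
    case less
    show ?case
    proof (cases "p = 0 \<or> Polynomial.degree p < Polynomial.degree q")
      case True
      then show ?thesis
        by (intro exI[of _ 0] exI[of _ p]) (use less.prems in \<open>auto simp: poly_over_0\<close>)
    next
      case False
      define m where "m = Polynomial.monom (Polynomial.lead_coeff p / Polynomial.lead_coeff q)
        (Polynomial.degree p - Polynomial.degree q)"
      have m: "m \<in> poly_over K"
        unfolding m_def using less.prems assms(2)
        by (intro poly_over_monom divide_mem) (auto simp: poly_over_def)
      have "p - m * q = 0 \<or> Polynomial.degree (p - m * q) < Polynomial.degree p"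
      proof -
        have d: "Polynomial.degree (m * q) = Polynomial.degree p"
          using False assms(3) by (simp add: m_def degree_mult_eq degree_monom_eq monom_eq_0_iff)
        have "Polynomial.coeff (p - m * q) (Polynomial.degree p) = 0"
          using False assms(3) lead_coeff_mult[of m q] d
          by (simp add: m_def monom_eq_0_iff degree_monom_eq)
        moreover have "Polynomial.degree (p - m * q) \<le> Polynomial.degree p"
          using d by (intro degree_diff_le) auto
        ultimately show ?thesis
          by (metis leading_coeff_0_iff le_neq_implies_less)
      qed
      moreover have over: "p - m * q \<in> poly_over K"
        using m less.prems assms(2) by (intro poly_over_diff poly_over_mult)
      ultimately obtain s r where sr: "s \<in> poly_over K" "r \<in> poly_over K" "p - m * q = s * q + r"
        "r = 0 \<or> Polynomial.degree r < Polynomial.degree q"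
      proof (cases "p - m * q = 0")
        case True
        then show ?thesis using that[of 0 0] by (simp add: poly_over_0)
      next
        case False
        with \<open>p - m * q = 0 \<or> _\<close> show ?thesis
          using less.hyps[of "p - m * q"] over that by blast
      qed
      show ?thesis
        by (intro exI[of _ "m + s"] exI[of _ r])
          (use sr m in \<open>auto simp: poly_over_add algebra_simps\<close>)
    qed
  qed
  then show ?thesis using that by blast
qed

end

text \<open>
  Minimality of the degree replaces irreducibility here. There is no normalisation: a minimal polynomial is
  determined only up to a nonzero constant of the subfield.
\<close>

definition min_poly_over :: "complex set \<Rightarrow> complex \<Rightarrow> complex poly \<Rightarrow> bool" where
  "min_poly_over K x M \<longleftrightarrow> M \<in> poly_over K \<and> M \<noteq> 0 \<and> poly M x = 0 \<and>
     (\<forall>P \<in> poly_over K. P \<noteq> 0 \<longrightarrow> poly P x = 0 \<longrightarrow> Polynomial.degree M \<le> Polynomial.degree P)"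

lemma min_poly_over_exists:
  assumes "P \<in> poly_over K" "P \<noteq> 0" "poly P x = 0"
  obtains M where "min_poly_over K x M"
proof -
  obtain M where "M \<in> poly_over K \<and> M \<noteq> 0 \<and> poly M x = 0"
    "\<And>P. P \<in> poly_over K \<and> P \<noteq> 0 \<and> poly P x = 0 \<Longrightarrow> Polynomial.degree M \<le> Polynomial.degree P"
    using ex_has_least_nat[of "\<lambda>M. M \<in> poly_over K \<and> M \<noteq> 0 \<and> poly M x = 0" P Polynomial.degree]
      assms by blast
  then show ?thesis using that[of M] by (auto simp: min_poly_over_def)
qed

context complex_subfield
begin

lemma min_poly_divides:
  assumes "min_poly_over K x M" "P \<in> poly_over K" "poly P x = 0"
  obtains S where "S \<in> poly_over K" "P = S * M"
proof -
  have M: "M \<in> poly_over K" "M \<noteq> 0" "poly M x = 0"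
    using assms(1) by (auto simp: min_poly_over_def)
  obtain s r where sr: "s \<in> poly_over K" "r \<in> poly_over K" "P = s * M + r"
    "r = 0 \<or> Polynomial.degree r < Polynomial.degree M"
    using poly_over_division[OF assms(2) M(1,2)] .
  have "poly r x = 0" using sr(3) assms(3) M(3) by simp
  with sr(2,4) have "r = 0" using assms(1) by (force simp: min_poly_over_def)
  with sr show ?thesis using that by simp
qed

lemma min_poly_degree_pos: "min_poly_over K x M \<Longrightarrow> Polynomial.degree M > 0"
proof (rule ccontr)
  assume M: "min_poly_over K x M" and "\<not> Polynomial.degree M > 0"
  then obtain a where "M = [:a:]" by (metis degree_eq_zeroE gr0I)
  then show False using M by (auto simp: min_poly_over_def)
qed

text \<open>
  This is the irreducibility of a minimal polynomial in disguise: a minimal polynomial \<open>N\<close> of another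
  root \<open>y\<close> of \<open>M\<close> divides \<open>M\<close>, and since \<open>x\<close> is a root of \<open>N\<close> or of the cofactor, the degree of \<open>N\<close>
  cannot be smaller than that of \<open>M\<close>.
\<close>

lemma min_poly_conjugate:
  assumes "min_poly_over K x M" "poly M y = 0"
  shows "min_poly_over K y M"
proof -
  have M: "M \<in> poly_over K" "M \<noteq> 0" "poly M x = 0"
    using assms(1) by (auto simp: min_poly_over_def)
  obtain N where N: "min_poly_over K y N"
    using min_poly_over_exists[OF M(1,2) assms(2)] .
  obtain S where S: "S \<in> poly_over K" "M = S * N"
    using min_poly_divides[OF N M(1) assms(2)] .
  have N': "N \<in> poly_over K" "N \<noteq> 0" "S \<noteq> 0" using N S M(2) by (auto simp: min_poly_over_def)
  have "poly S x = 0 \<or> poly N x = 0" using S M(3) by simp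
  then have "Polynomial.degree M \<le> Polynomial.degree S \<or> Polynomial.degree M \<le> Polynomial.degree N"
    using assms(1) N' S(1) by (auto simp: min_poly_over_def)
  moreover have "Polynomial.degree M = Polynomial.degree S + Polynomial.degree N"
    using S N' by (simp add: degree_mult_eq)
  moreover note min_poly_degree_pos[OF N]
  ultimately have "Polynomial.degree M \<le> Polynomial.degree N" by linarith
  then show ?thesis using N M assms(2) by (fastforce simp: min_poly_over_def)
qed

text \<open>
  In characteristic 0 the derivative is a nonzero polynomial of smaller degree, so by minimality it does
  not vanish at \<open>x\<close>.
\<close>

lemma min_poly_simple_root:
  assumes "min_poly_over K x M"
  shows "poly (pderiv M) x \<noteq> 0"
proof
  assume *: "poly (pderiv M) x = 0"
  have "pderiv M \<in> poly_over K" "pderiv M \<noteq> 0"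
    using assms min_poly_degree_pos[OF assms]
    by (auto simp: min_poly_over_def poly_over_pderiv pderiv_eq_0_iff)
  then have "Polynomial.degree M \<le> Polynomial.degree (pderiv M)"
    using * assms by (auto simp: min_poly_over_def)
  then show False using min_poly_degree_pos[OF assms] by (simp add: degree_pderiv)
qed

lemma min_poly_rsquarefree:
  assumes "min_poly_over K x M"
  shows "rsquarefree M"
  using assms min_poly_conjugate min_poly_simple_root by (auto simp: rsquarefree_roots)

end

section \<open>Primitive elements\<close>

lemma poly_over_mono: "K \<subseteq> L \<Longrightarrow> poly_over K \<subseteq> poly_over L"
  by (auto simp: poly_over_def)

text \<open>
  Reduce \<open>M\<close> modulo \<open>h\<close>: if \<open>M = s h + r\<close>, then \<open>r(x) = - s(x) h(x)\<close>, so an inverse of \<open>r(x)\<close> gives an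
  inverse of \<open>h(x)\<close>, and \<open>r\<close> has smaller degree than \<open>h\<close>. The descent needs \<open>r(x) \<noteq> 0\<close>, which minimality
  of \<open>M\<close> gives once \<open>deg h < deg M\<close>; the general case is reduced to this one by dividing \<open>h\<close> by \<open>M\<close>.
\<close>

lemma inverse_poly_value:
  assumes M: "min_poly_over \<rat> x M" and "h \<in> poly_over \<rat>" "poly h x \<noteq> 0"
  shows "\<exists>g \<in> poly_over \<rat>. inverse (poly h x) = poly g x"
proof -
  interpret Q: complex_subfield \<rat> by (rule complex_subfield_Rats)
  have M': "M \<in> poly_over \<rat>" "M \<noteq> 0" "poly M x = 0"
    using M by (auto simp: min_poly_over_def)
  have vanish: "g = 0" if "g \<in> poly_over \<rat>" "poly g x = 0" "Polynomial.degree g < Polynomial.degree M" for g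
    using M that by (force simp: min_poly_over_def)
  have small: "\<exists>g \<in> poly_over \<rat>. inverse (poly h x) = poly g x"
    if "h \<in> poly_over \<rat>" "poly h x \<noteq> 0" "Polynomial.degree h < Polynomial.degree M" for h
    using that
  proof (induction "Polynomial.degree h" arbitrary: h rule: less_induct)
    case less
    have h0: "h \<noteq> 0" using less.prems by auto
    show ?case
    proof (cases "Polynomial.degree h = 0")
      case True
      then obtain a where a: "h = [:a:]" by (metis degree_eq_zeroE)
      then have "a \<in> \<rat>" using less.prems by (auto simp: poly_over_def dest: spec[of _ 0])
      then have "[:inverse a:] \<in> poly_over \<rat>" by (intro Q.poly_over_pCons Q.poly_over_0) auto
      then show ?thesis using a by (intro bexI[of _ "[:inverse a:]"]) auto
    next
      case False
      obtain s r where sr: "s \<in> poly_over \<rat>" "r \<in> poly_over \<rat>" "M = s * h + r"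
        "r = 0 \<or> Polynomial.degree r < Polynomial.degree h"
        using Q.poly_over_division[of M h] M' less.prems h0 by auto
      have rx: "poly r x = - (poly s x * poly h x)"
        using sr(3) M' by (simp add: add_eq_0_iff2)
      have "poly r x \<noteq> 0"
      proof
        assume "poly r x = 0"
        then have "r = 0" using sr(2,4) less.prems(3) vanish[of r] by fastforce
        then have "M = s * h" "poly s x = 0" using sr(3) rx less.prems by simp_all
        then have "s \<noteq> 0" "Polynomial.degree s < Polynomial.degree M"
          using M' h0 False by (auto simp: degree_mult_eq)
        then show False using vanish[of s] sr(1) \<open>poly s x = 0\<close> by blast
      qed
      moreover have "Polynomial.degree r < Polynomial.degree h" using sr(4) calculation by auto
      ultimately obtain g where g: "g \<in> poly_over \<rat>" "inverse (poly r x) = poly g x"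
        using less.hyps[of r] sr(2) less.prems(3) by force
      have "inverse (poly h x) = poly (0 - s * g) x"
        using \<open>poly r x \<noteq> 0\<close> less.prems(2) unfolding rx
        by (simp add: g(2)[symmetric] rx field_simps)
      then show ?thesis using Q.poly_over_diff[OF Q.poly_over_0 Q.poly_over_mult[OF sr(1) g(1)]] by blast
    qed
  qed
  obtain s r where sr: "s \<in> poly_over \<rat>" "r \<in> poly_over \<rat>" "h = s * M + r"
        "r = 0 \<or> Polynomial.degree r < Polynomial.degree M"
    using Q.poly_over_division[of h M] M' assms by auto
  then have "poly h x = poly r x" using M' by simp
  with small[of r] sr assms(3) show ?thesis by force
qed

lemma adjoin_rat_singleton:
  assumes M: "min_poly_over \<rat> x M"
  shows "adjoin_rat {x} = (\<lambda>h. poly h x) ` poly_over \<rat>"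
proof
  interpret Q: complex_subfield \<rat> by (rule complex_subfield_Rats)
  interpret A: complex_subfield "adjoin_rat {x}" by (rule complex_subfield_adjoin_rat)
  have "complex_subfield ((\<lambda>h. poly h x) ` poly_over \<rat>)"
  proof
    show "1 \<in> (\<lambda>h. poly h x) ` poly_over \<rat>"
      using Q.poly_over_pCons[OF Q.one_mem Q.poly_over_0] by (force intro!: image_eqI[of _ _ "[:1:]"])
    show "inverse y \<in> (\<lambda>h. poly h x) ` poly_over \<rat>"
      if "y \<in> (\<lambda>h. poly h x) ` poly_over \<rat>" "y \<noteq> 0" for y
      using inverse_poly_value[OF M] that by (auto simp: image_iff)
    show "- y \<in> (\<lambda>h. poly h x) ` poly_over \<rat>" if "y \<in> (\<lambda>h. poly h x) ` poly_over \<rat>" for y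
      using that by (auto intro!: image_eqI[of _ _ "0 - _"] Q.poly_over_diff Q.poly_over_0)
    show "y + z \<in> (\<lambda>h. poly h x) ` poly_over \<rat>"
      if "y \<in> (\<lambda>h. poly h x) ` poly_over \<rat>" "z \<in> (\<lambda>h. poly h x) ` poly_over \<rat>" for y z
      using that by (auto intro!: image_eqI[of _ _ "_ + _"] Q.poly_over_add)
    show "y * z \<in> (\<lambda>h. poly h x) ` poly_over \<rat>"
      if "y \<in> (\<lambda>h. poly h x) ` poly_over \<rat>" "z \<in> (\<lambda>h. poly h x) ` poly_over \<rat>" for y z
      using that by (auto intro!: image_eqI[of _ _ "_ * _"] Q.poly_over_mult)
  qed
  moreover have "x \<in> (\<lambda>h. poly h x) ` poly_over \<rat>"
    by (intro image_eqI[of _ _ "[:0, 1:]"] Q.poly_over_pCons Q.poly_over_0) auto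
  ultimately show "adjoin_rat {x} \<subseteq> (\<lambda>h. poly h x) ` poly_over \<rat>"
    by (intro adjoin_rat_minimal) auto
  show "(\<lambda>h. poly h x) ` poly_over \<rat> \<subseteq> adjoin_rat {x}"
    using A.poly_mem poly_over_mono[OF A.Rats_subset] adjoin_rat_incl by blast
qed

text \<open>
  For \<open>g = a + k b\<close> the numbers \<open>v = b\<close> and \<open>u = a\<close> satisfy \<open>N(v) = 0\<close> and \<open>F(u) = 0\<close> with \<open>u = g - k v\<close>. All but
  finitely many \<open>k\<close> exclude every other such pair of roots. For such \<open>k\<close>, the minimal polynomial of \<open>b\<close> over
  \<open>\<rat>(g)\<close>, which divides both \<open>N\<close> and \<open>F(g - k X)\<close>, has \<open>b\<close> as its only root. As \<open>b\<close> is a simple root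
  of \<open>N\<close>, this polynomial is linear, and \<open>b\<close> is in \<open>\<rat>(g)\<close>.
\<close>

lemma primitive_element_pair:
  assumes F: "F \<in> poly_over \<rat>" "F \<noteq> 0" "poly F a = 0"
    and G: "G \<in> poly_over \<rat>" "G \<noteq> 0" "poly G b = 0"
  obtains k :: int where "a \<in> adjoin_rat {a + of_int k * b}" "b \<in> adjoin_rat {a + of_int k * b}"
proof -
  interpret Q: complex_subfield \<rat> by (rule complex_subfield_Rats)
  obtain N where N: "min_poly_over \<rat> b N" using min_poly_over_exists[OF G] .
  then have N': "N \<in> poly_over \<rat>" "N \<noteq> 0" "poly N b = 0" by (auto simp: min_poly_over_def)
  \<comment> \<open>The values of \<open>k\<close> for which \<open>a + k b = u + k v\<close> with \<open>v \<noteq> b\<close>; division by zero only adds the value \<open>0\<close>.\<close>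
  define bad where "bad = (\<lambda>(u, v). (u - a) / (b - v)) ` ({u. poly F u = 0} \<times> {v. poly N v = 0})"
  have "finite bad" unfolding bad_def using F N' by (auto intro!: poly_roots_finite)
  moreover have "infinite (range (of_int :: int \<Rightarrow> complex))"
    using infinite_UNIV_int by (subst finite_image_iff) (auto simp: inj_def)
  ultimately obtain k :: int where k: "of_int k \<notin> bad"
    by (metis (no_types, opaque_lifting) UNIV_I image_subset_iff rev_finite_subset)
  define g where "g = a + of_int k * b"
  interpret A: complex_subfield "adjoin_rat {g}" by (rule complex_subfield_adjoin_rat)
  have g: "g \<in> adjoin_rat {g}" by (simp add: adjoin_rat_incl)
  have Q_sub: "poly_over \<rat> \<subseteq> poly_over (adjoin_rat {g})" by (intro poly_over_mono A.Rats_subset)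
  define H where "H = pcompose F [:g, - of_int k:]"
  have H: "H \<in> poly_over (adjoin_rat {g})"
    unfolding H_def using F(1) Q_sub
    by (intro A.poly_over_pcompose A.poly_over_pCons A.poly_over_0 A.uminus_mem A.of_int_mem g) auto
  have Hb: "poly H b = 0" by (simp add: H_def poly_pcompose g_def F)
  obtain M where M: "min_poly_over (adjoin_rat {g}) b M"
    using min_poly_over_exists N' Q_sub by blast
  \<comment> \<open>\<open>N\<close> and \<open>H\<close> are polynomials over \<open>\<rat>(g)\<close> that vanish at \<open>b\<close>, so \<open>M\<close> divides both.\<close>
  obtain S where S: "N = S * M" using A.min_poly_divides[OF M] N' Q_sub by blast
  obtain T where T: "H = T * M" using A.min_poly_divides[OF M H Hb] by blast
  have only_root: "v = b" if "poly M v = 0" for v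
  proof (rule ccontr)
    assume "v \<noteq> b"
    have "poly N v = 0" "poly F (g - of_int k * v) = 0"
      using that S T by (auto simp: H_def poly_pcompose algebra_simps dest: arg_cong[of _ _ "\<lambda>p. poly p v"])
    moreover have "of_int k = ((g - of_int k * v) - a) / (b - v)"
      using \<open>v \<noteq> b\<close> by (simp add: g_def field_simps)
    ultimately have "of_int k \<in> bad"
      unfolding bad_def by (intro image_eqI[of _ _ "(g - of_int k * v, v)"]) auto
    then show False using k by contradiction
  qed
  have Mb: "poly M b = 0" "M \<noteq> 0" "M \<in> poly_over (adjoin_rat {g})" using M by (auto simp: min_poly_over_def)
  then obtain L where L: "M = [:- b, 1:] * L" by (metis dvdE poly_eq_0_iff_dvd)
  have "Polynomial.degree L = 0"
  proof (rule ccontr)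
    assume "Polynomial.degree L \<noteq> 0"
    then obtain v where v: "poly L v = 0"
      using fundamental_theorem_of_algebra[of L] by (auto simp: constant_degree)
    then have "poly M v = 0" using L by simp
    then have "v = b" by (rule only_root)
    then have "poly L b = 0" using v by simp
    then have "poly (pderiv N) b = 0"
      unfolding S L pderiv_mult poly_add poly_mult by simp
    then show False using Q.min_poly_simple_root[OF N] by contradiction
  qed
  then obtain l where l: "L = [:l:]" by (metis degree_eq_zeroE)
  have "l \<noteq> 0" using L l Mb by auto
  have "Polynomial.coeff M 0 = - b * l" "Polynomial.coeff M 1 = l" using L l by simp_all
  then have "l \<in> adjoin_rat {g}" "- b * l \<in> adjoin_rat {g}"
    using Mb(3) unfolding poly_over_def by (metis (mono_tags, lifting) mem_Collect_eq)+
  then have "- ((- b * l) / l) \<in> adjoin_rat {g}" by (intro A.uminus_mem A.divide_mem)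
  then have b: "b \<in> adjoin_rat {g}" using \<open>l \<noteq> 0\<close> by simp
  have "g - of_int k * b \<in> adjoin_rat {g}" by (intro A.diff_mem A.mult_mem A.of_int_mem g b)
  then have "a \<in> adjoin_rat {g}" by (simp add: g_def)
  with b show ?thesis using that g_def by blast
qed

lemma algebraic_iff_poly_over: "algebraic x \<longleftrightarrow> (\<exists>P \<in> poly_over \<rat>. P \<noteq> 0 \<and> poly P x = 0)"
  unfolding algebraic_altdef poly_over_def by blast

lemma algebraic_min_poly:
  assumes "algebraic x" obtains M where "min_poly_over \<rat> x M"
  using assms min_poly_over_exists unfolding algebraic_iff_poly_over by blast

interpretation rat_space: vector_space "\<lambda>(q::rat) (z::complex). of_rat q * z"
  by unfold_locales (simp_all add: algebra_simps of_rat_add of_rat_mult)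

text \<open>
  More powers of \<open>x\<close> than the dimension of the span are linearly dependent over \<open>\<rat>\<close>, and a linear
  dependence between powers of \<open>x\<close> is a polynomial that vanishes at \<open>x\<close>.
\<close>

lemma algebraic_if_powers_in_finite_span:
  assumes V: "finite V" and pow: "\<And>n. x ^ n \<in> rat_space.span V"
  shows "algebraic x"
proof -
  interpret Q: complex_subfield \<rat> by (rule complex_subfield_Rats)
  define n where "n = card V"
  show ?thesis
  proof (cases "inj_on (\<lambda>i. x ^ i) {..n}")
    case False
    then obtain i j where ij: "i \<noteq> j" "x ^ i = x ^ j" by (auto simp: inj_on_def)
    define P :: "complex poly" where "P = Polynomial.monom 1 i - Polynomial.monom 1 j"
    have "P \<in> poly_over \<rat>" unfolding P_def by (intro Q.poly_over_diff Q.poly_over_monom) auto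
    moreover have "Polynomial.coeff P i = 1" using ij by (simp add: P_def)
    then have "P \<noteq> 0" by auto
    moreover have "poly P x = 0" using ij by (simp add: P_def poly_monom)
    ultimately show ?thesis unfolding algebraic_iff_poly_over by blast
  next
    case True
    define S where "S = (\<lambda>i. x ^ i) ` {..n}"
    have "card S = Suc n" unfolding S_def using True by (simp add: card_image)
    have "\<not> rat_space.independent S"
    proof
      assume "rat_space.independent S"
      then have "card S \<le> card V"
        using rat_space.independent_span_bound[OF V, of S] pow by (auto simp: S_def)
      then show False using \<open>card S = Suc n\<close> by (simp add: n_def)
    qed
    then obtain u v where u: "(\<Sum>v\<in>S. of_rat (u v) * v) = 0" "v \<in> S" "u v \<noteq> 0"
      using rat_space.dependent_finite[of S] by (auto simp: S_def)
    define P :: "complex poly" where "P = (\<Sum>i\<le>n. Polynomial.monom (of_rat (u (x ^ i))) i)"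
    have coeff: "Polynomial.coeff P i = (if i \<le> n then of_rat (u (x ^ i)) else 0)" for i
      by (simp add: P_def coeff_sum if_distrib cong: if_cong)
    have "P \<in> poly_over \<rat>" by (simp add: poly_over_def coeff)
    moreover obtain i where "v = x ^ i" "i \<le> n" using u(2) by (auto simp: S_def)
    then have "Polynomial.coeff P i \<noteq> 0" using u(3) by (simp add: coeff)
    then have "P \<noteq> 0" by auto
    moreover have "poly P x = (\<Sum>v\<in>S. of_rat (u v) * v)"
      unfolding S_def P_def using True by (simp add: poly_sum poly_monom sum.reindex)
    then have "poly P x = 0" using u(1) by simp
    ultimately show ?thesis unfolding algebraic_iff_poly_over by blast
  qed
qed

lemma power_in_terms_of_small_powers:
  fixes x :: complex
  assumes "algebraic x"
  obtains m where "\<And>n. \<exists>c :: nat \<Rightarrow> rat. x ^ n = (\<Sum>i<m. of_rat (c i) * x ^ i)"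
proof -
  interpret Q: complex_subfield \<rat> by (rule complex_subfield_Rats)
  obtain P where P: "P \<in> poly_over \<rat>" "P \<noteq> 0" "poly P x = 0"
    using assms by (auto simp: algebraic_iff_poly_over)
  have "\<exists>c :: nat \<Rightarrow> rat. x ^ n = (\<Sum>i<Suc (Polynomial.degree P). of_rat (c i) * x ^ i)" for n
  proof -
    have "Polynomial.monom 1 n \<in> poly_over \<rat>" by (intro Q.poly_over_monom) simp
    then obtain s r where sr: "s \<in> poly_over \<rat>" "r \<in> poly_over \<rat>" "Polynomial.monom 1 n = s * P + r"
      "r = 0 \<or> Polynomial.degree r < Polynomial.degree P"
      using Q.poly_over_division[OF _ P(1,2)] by metis
    have "\<exists>q. Polynomial.coeff r i = of_rat q" for i
      using sr(2) by (auto simp: poly_over_def elim!: Rats_cases)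
    then obtain c where c: "Polynomial.coeff r i = of_rat (c i)" for i by metis
    have "x ^ n = poly (Polynomial.monom 1 n) x" by (simp add: poly_monom)
    also have "\<dots> = poly r x" using sr(3) P(3) by simp
    also have "\<dots> = (\<Sum>i\<le>Polynomial.degree P. Polynomial.coeff r i * x ^ i)"
      unfolding poly_altdef
      using sr(4) by (intro sum.mono_neutral_left) (auto simp: coeff_eq_0)
    finally show ?thesis by (auto simp: c lessThan_Suc_atMost)
  qed
  then show ?thesis using that by blast
qed

text \<open>
  The powers of \<open>a + k b\<close> are combinations of products \<open>a\<^sup>i b\<^sup>j\<close>, and all of these lie in the span of
  finitely many of them, since a power of \<open>a\<close> or \<open>b\<close> can be reduced modulo a polynomial with that root.
\<close>

lemma algebraic_add_int_mult:
  assumes a: "algebraic a" and b: "algebraic b"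
  shows "algebraic (a + of_int k * b :: complex)"
proof -
  obtain m where m: "\<And>n. \<exists>c :: nat \<Rightarrow> rat. a ^ n = (\<Sum>i<m. of_rat (c i) * a ^ i)"
    using power_in_terms_of_small_powers[OF a] by blast
  obtain l where l: "\<And>n. \<exists>c :: nat \<Rightarrow> rat. b ^ n = (\<Sum>i<l. of_rat (c i) * b ^ i)"
    using power_in_terms_of_small_powers[OF b] by blast
  define V where "V = (\<lambda>(i, j). a ^ i * b ^ j) ` ({..<m} \<times> {..<l})"
  have prod: "a ^ i * b ^ j \<in> rat_space.span V" for i j
  proof -
    obtain c d where cd: "a ^ i = (\<Sum>i<m. of_rat (c i) * a ^ i)" "b ^ j = (\<Sum>i<l. of_rat (d i) * b ^ i)"
      using m[of i] l[of j] by blast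
    have "a ^ i * b ^ j = (\<Sum>p<m. \<Sum>q<l. of_rat (c p * d q) * (a ^ p * b ^ q))"
      unfolding cd by (simp add: sum_product of_rat_mult algebra_simps)
    also have "\<dots> \<in> rat_space.span V"
      by (intro rat_space.span_sum rat_space.span_scale rat_space.span_base) (auto simp: V_def)
    finally show ?thesis .
  qed
  have "(a + of_int k * b) ^ n \<in> rat_space.span V" for n
  proof -
    have "(a + of_int k * b) ^ n
      = (\<Sum>i\<le>n. of_rat (of_nat (n choose i) * of_int k ^ (n - i)) * (a ^ i * b ^ (n - i)))"
      by (simp add: binomial_ring power_mult_distrib of_rat_mult of_rat_power algebra_simps)
    also have "\<dots> \<in> rat_space.span V"
      by (intro rat_space.span_sum rat_space.span_scale prod)
    finally show ?thesis .
  qed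
  then show ?thesis
    by (intro algebraic_if_powers_in_finite_span[of V]) (simp_all add: V_def)
qed

lemma adjoin_rat_subset_iff: "adjoin_rat S \<subseteq> adjoin_rat T \<longleftrightarrow> S \<subseteq> adjoin_rat T"
  using adjoin_rat_minimal[OF complex_subfield_adjoin_rat, of S T] adjoin_rat_incl by blast

lemma primitive_element:
  assumes "finite S" "\<And>a. a \<in> S \<Longrightarrow> algebraic a"
  obtains g where "algebraic g" "adjoin_rat {g} = adjoin_rat S"
proof -
  have "\<exists>g. algebraic g \<and> adjoin_rat {g} = adjoin_rat S"
    using assms
  proof (induction S rule: finite_induct)
    case empty
    interpret A: complex_subfield "adjoin_rat {}" by (rule complex_subfield_adjoin_rat)
    have "adjoin_rat {0} = adjoin_rat {}"
      by (intro equalityI) (simp_all add: adjoin_rat_subset_iff A.zero_mem)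
    then show ?case by (intro exI[of _ 0]) auto
  next
    case (insert a S)
    obtain g where g: "algebraic g" "adjoin_rat {g} = adjoin_rat S" using insert by auto
    obtain k :: int where k: "a \<in> adjoin_rat {a + of_int k * g}" "g \<in> adjoin_rat {a + of_int k * g}"
      using primitive_element_pair insert.prems[of a] g(1) unfolding algebraic_iff_poly_over
      by (metis insertI1)
    interpret A: complex_subfield "adjoin_rat (insert a S)" by (rule complex_subfield_adjoin_rat)
    have "adjoin_rat {g} \<subseteq> adjoin_rat (insert a S)"
      unfolding g(2) adjoin_rat_subset_iff by (auto intro: adjoin_rat_incl)
    then have "g \<in> adjoin_rat (insert a S)" by (auto intro: adjoin_rat_incl)
    then have "a + of_int k * g \<in> adjoin_rat (insert a S)"
      by (intro A.add_mem A.mult_mem A.of_int_mem) (auto intro: adjoin_rat_incl)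
    moreover have "S \<subseteq> adjoin_rat {a + of_int k * g}"
      using k(2) g(2) adjoin_rat_subset_iff[of "{g}"] adjoin_rat_subset_iff[of S] by auto
    ultimately have "adjoin_rat {a + of_int k * g} = adjoin_rat (insert a S)"
      using k(1) by (intro equalityI) (simp_all add: adjoin_rat_subset_iff)
    then show ?case using algebraic_add_int_mult insert.prems[of a] g(1) by blast
  qed
  then show ?thesis using that by blast
qed

section \<open>The fixed field of the automorphism group of a splitting field\<close>

lemma rat_automorphismsI:
  assumes "\<phi> \<in> extensional L" "bij_betw \<phi> L L"
    and "\<And>x y. x \<in> L \<Longrightarrow> y \<in> L \<Longrightarrow> \<phi> (x + y) = \<phi> x + \<phi> y"
    and "\<And>x y. x \<in> L \<Longrightarrow> y \<in> L \<Longrightarrow> \<phi> (x * y) = \<phi> x * \<phi> y"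
    and "\<And>q. q \<in> \<rat> \<Longrightarrow> \<phi> q = q"
  shows "\<phi> \<in> rat_automorphisms L"
  using assms bij_betwE[OF assms(2)]
  by (auto simp: rat_automorphisms_def Bij_def ring_iso_def ring_hom_def complex_field_simps)

lemma rat_automorphismsD:
  assumes "\<phi> \<in> rat_automorphisms L"
  shows "\<phi> \<in> extensional L" "bij_betw \<phi> L L" "\<phi> \<in> Bij L"
    and "\<And>x y. x \<in> L \<Longrightarrow> y \<in> L \<Longrightarrow> \<phi> (x + y) = \<phi> x + \<phi> y"
    and "\<And>x y. x \<in> L \<Longrightarrow> y \<in> L \<Longrightarrow> \<phi> (x * y) = \<phi> x * \<phi> y"
    and "\<And>q. q \<in> \<rat> \<Longrightarrow> \<phi> q = q"
    and "\<And>x. x \<in> L \<Longrightarrow> \<phi> x \<in> L"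
  using assms by (auto simp: rat_automorphisms_def Bij_def ring_iso_def ring_hom_def complex_field_simps
     dest: bij_betwE)

text \<open>
  The map \<open>h(g) \<mapsto> h(g')\<close> is a well defined injective homomorphism because a rational polynomial vanishes
  at \<open>g\<close> exactly when it vanishes at \<open>g'\<close>. That it maps the field onto itself is due to normality: it
  permutes the roots of \<open>F\<close>, and these generate the field.
\<close>

lemma conjugate_roots_automorphism:
  assumes M: "min_poly_over \<rat> g M" and g': "poly M g' = 0"
    and F: "F \<in> poly_over \<rat>" "F \<noteq> 0" and L: "adjoin_rat {g} = adjoin_rat {z. poly F z = 0}"
  obtains \<phi> where "\<phi> \<in> rat_automorphisms (adjoin_rat {g})"
    "\<And>h. h \<in> poly_over \<rat> \<Longrightarrow> \<phi> (poly h g) = poly h g'"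
proof -
  interpret Q: complex_subfield \<rat> by (rule complex_subfield_Rats)
  let ?L = "adjoin_rat {g}"
  interpret L: complex_subfield ?L by (rule complex_subfield_adjoin_rat)
  define \<phi> where "\<phi> = (\<lambda>x\<in>?L. poly (SOME h. h \<in> poly_over \<rat> \<and> poly h g = x) g')"
  note M' = Q.min_poly_conjugate[OF M g']
  have elem: "?L = (\<lambda>h. poly h g) ` poly_over \<rat>" by (rule adjoin_rat_singleton[OF M])
  have agree: "poly h g = poly k g \<longleftrightarrow> poly h g' = poly k g'"
    if "h \<in> poly_over \<rat>" "k \<in> poly_over \<rat>" for h k
  proof
    have hk: "h - k \<in> poly_over \<rat>" using that by (rule Q.poly_over_diff)
    show "poly h g' = poly k g'" if "poly h g = poly k g"
      using Q.min_poly_divides[OF M hk] that g'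
      by (metis eq_iff_diff_eq_0 mult_zero_right poly_diff poly_mult)
    have "poly M g = 0" using M by (simp add: min_poly_over_def)
    then show "poly h g = poly k g" if "poly h g' = poly k g'"
      using Q.min_poly_divides[OF M' hk] that
      by (metis eq_iff_diff_eq_0 mult_zero_right poly_diff poly_mult)
  qed
  have \<phi>: "\<phi> (poly h g) = poly h g'" if h: "h \<in> poly_over \<rat>" for h
  proof -
    have "\<exists>k. k \<in> poly_over \<rat> \<and> poly k g = poly h g" using h by blast
    from someI_ex[OF this] show ?thesis
      using agree[OF _ h] elem h by (auto simp: \<phi>_def)
  qed
  have add: "\<phi> (x + y) = \<phi> x + \<phi> y" if xy: "x \<in> ?L" "y \<in> ?L" for x y
  proof -
    obtain h k where hk: "h \<in> poly_over \<rat>" "x = poly h g" "k \<in> poly_over \<rat>" "y = poly k g"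
      using xy elem by auto
    then show ?thesis using \<phi>[OF Q.poly_over_add[OF hk(1,3)]] by (simp add: \<phi>)
  qed
  have mult: "\<phi> (x * y) = \<phi> x * \<phi> y" if xy: "x \<in> ?L" "y \<in> ?L" for x y
  proof -
    obtain h k where hk: "h \<in> poly_over \<rat>" "x = poly h g" "k \<in> poly_over \<rat>" "y = poly k g"
      using xy elem by auto
    then show ?thesis using \<phi>[OF Q.poly_over_mult[OF hk(1,3)]] by (simp add: \<phi>)
  qed
  have rat: "\<phi> q = q" if "q \<in> \<rat>" for q
    using \<phi>[OF Q.poly_over_pCons[OF that Q.poly_over_0]] by simp
  have inj: "inj_on \<phi> ?L"
    using agree by (auto simp: inj_on_def elem \<phi>)
  let ?R = "{z. poly F z = 0}"
  have R_L: "?R \<subseteq> ?L" unfolding L by (auto intro: adjoin_rat_incl)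
  have "\<phi> z \<in> ?R" if z: "z \<in> ?R" for z
  proof -
    obtain h where h: "h \<in> poly_over \<rat>" "z = poly h g" using z R_L elem by blast
    have "poly (pcompose F h) g = poly 0 g" using z h by (simp add: poly_pcompose)
    then have "poly (pcompose F h) g' = 0"
      using agree[OF Q.poly_over_pcompose[OF F(1) h(1)] Q.poly_over_0] by simp
    then show ?thesis using h by (simp add: poly_pcompose \<phi>)
  qed
  then have R_image: "\<phi> ` ?R = ?R"
    using inj R_L F(2) by (intro endo_inj_surj poly_roots_finite) (auto intro: inj_on_subset)
  \<comment> \<open>The image is a field that contains all roots of \<open>F\<close>, hence contains \<open>L\<close>; the elements that \<open>\<phi>\<close> maps
    into \<open>L\<close> form a field with the same property, hence the image is contained in \<open>L\<close>.\<close>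
  have image: "\<phi> ` ?L = adjoin_rat {g'}"
    unfolding elem adjoin_rat_singleton[OF M'] image_image by (intro image_cong) (auto simp: \<phi>)
  have "complex_subfield {x \<in> ?L. \<phi> x \<in> ?L}"
  proof
    show "1 \<in> {x \<in> ?L. \<phi> x \<in> ?L}" using rat[of 1] by (simp add: L.one_mem)
    fix x assume x: "x \<in> {x \<in> ?L. \<phi> x \<in> ?L}"
    have "\<phi> (- 1 * x) = - 1 * \<phi> x"
      using x mult[of "- 1" x] rat[of "- 1"] by (simp add: L.one_mem L.uminus_mem)
    then show "- x \<in> {x \<in> ?L. \<phi> x \<in> ?L}" using x by (simp add: L.uminus_mem)
    show "inverse x \<in> {x \<in> ?L. \<phi> x \<in> ?L}" if "x \<noteq> 0"
    proof -
      have "\<phi> x * \<phi> (inverse x) = 1"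
        using mult[of x "inverse x"] x that rat[of 1] by (simp add: L.inverse_mem)
      then have "\<phi> (inverse x) = inverse (\<phi> x)" by (rule inverse_unique[symmetric])
      then show ?thesis
        using x that by (cases "\<phi> x = 0") (simp_all add: L.inverse_mem L.zero_mem)
    qed
    fix y assume y: "y \<in> {x \<in> ?L. \<phi> x \<in> ?L}"
    show "x + y \<in> {x \<in> ?L. \<phi> x \<in> ?L}" using x y by (simp add: L.add_mem add)
    show "x * y \<in> {x \<in> ?L. \<phi> x \<in> ?L}" using x y by (simp add: L.mult_mem mult)
  qed
  then have "?L \<subseteq> {x \<in> ?L. \<phi> x \<in> ?L}"
    using R_image R_L unfolding L by (intro adjoin_rat_minimal) auto
  then have "\<phi> ` ?L \<subseteq> ?L" by auto
  moreover have "?L \<subseteq> adjoin_rat {g'}"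
    unfolding L using R_image R_L image by (subst adjoin_rat_subset_iff) blast
  ultimately have "bij_betw \<phi> ?L ?L" using inj image by (auto simp: bij_betw_def)
  then have "\<phi> \<in> rat_automorphisms ?L"
    using add mult rat by (intro rat_automorphismsI) (auto simp: \<phi>_def)
  then show ?thesis using \<phi> that by blast
qed

lemma card_roots_rsquarefree:
  assumes "rsquarefree (p :: complex poly)"
  shows "card {z. poly p z = 0} = Polynomial.degree p"
proof -
  have p: "p \<noteq> 0" using assms by (simp add: rsquarefree_def)
  have "Polynomial.degree p = Polynomial.degree (\<Prod>z | poly p z = 0. [:- z, 1:])"
    using p complex_poly_decompose_rsquarefree[OF assms] by (metis degree_smult_eq leading_coeff_0_iff)
  also have "\<dots> = card {z. poly p z = 0}" by (subst degree_prod_sum_eq) auto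
  finally show ?thesis ..
qed

text \<open>
  This is the theorem of Galois theory on which the argument rests. An element outside \<open>\<rat>\<close> is \<open>h(g)\<close> for
  a primitive element \<open>g\<close> and a nonconstant \<open>h\<close> of degree smaller than the number of conjugates of \<open>g\<close>, so
  \<open>h\<close> does not take the same value at all of them.
\<close>

theorem fixed_field_rational:
  assumes F: "F \<in> poly_over \<rat>" "F \<noteq> 0"
    and x: "x \<in> adjoin_rat {z. poly F z = 0}"
    and fixed: "\<And>\<phi>. \<phi> \<in> rat_automorphisms (adjoin_rat {z. poly F z = 0}) \<Longrightarrow> \<phi> x = x"
  shows "x \<in> \<rat>"
proof -
  interpret Q: complex_subfield \<rat> by (rule complex_subfield_Rats)
  obtain g where g: "algebraic g" "adjoin_rat {g} = adjoin_rat {z. poly F z = 0}"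
  proof (rule primitive_element)
    show "finite {z. poly F z = 0}" using F(2) by (rule poly_roots_finite)
    show "algebraic a" if "a \<in> {z. poly F z = 0}" for a
      using that F unfolding algebraic_iff_poly_over by blast
  qed
  obtain M where M: "min_poly_over \<rat> g M" using algebraic_min_poly[OF g(1)] .
  then have M': "M \<in> poly_over \<rat>" "M \<noteq> 0" "poly M g = 0" by (auto simp: min_poly_over_def)
  obtain k where k: "k \<in> poly_over \<rat>" "x = poly k g"
    using x g(2) adjoin_rat_singleton[OF M] by auto
  obtain s h where h: "h \<in> poly_over \<rat>" "k = s * M + h"
    "h = 0 \<or> Polynomial.degree h < Polynomial.degree M"
    using Q.poly_over_division[OF k(1) M'(1,2)] by metis
  have xh: "x = poly h g" using k h M' by simp
  define H where "H = h - [:x:]"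
  have roots: "{z. poly M z = 0} \<subseteq> {z. poly H z = 0}"
  proof safe
    fix g' assume "poly M g' = 0"
    then obtain \<phi> where "\<phi> \<in> rat_automorphisms (adjoin_rat {g})" "\<phi> (poly h g) = poly h g'"
      using conjugate_roots_automorphism[OF M _ F g(2)] h(1) by metis
    then show "poly H g' = 0" using fixed[of \<phi>] g(2) xh by (simp add: H_def)
  qed
  have deg: "Polynomial.degree H < Polynomial.degree M"
    unfolding H_def using h(3) Q.min_poly_degree_pos[OF M] by (intro degree_diff_less) auto
  have "H = 0"
  proof (rule ccontr)
    assume "H \<noteq> 0"
    then have "card {z. poly M z = 0} \<le> Polynomial.degree H"
      using roots card_mono[OF poly_roots_finite roots] card_poly_roots_bound[of H] by force
    then show False
      using deg card_roots_rsquarefree[OF Q.min_poly_rsquarefree[OF M]] by simp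
  qed
  then have "h = [:x:]" by (simp add: H_def)
  then show ?thesis using h(1) by (auto simp: poly_over_def dest: spec[of _ 0])
qed

section \<open>Irreducible polynomials and cyclic Galois groups\<close>

lemma of_rat_poly_mult:
  "Polynomial.map_poly (of_rat :: rat \<Rightarrow> complex) (p * q)
     = Polynomial.map_poly of_rat p * Polynomial.map_poly of_rat q"
  by (intro poly_eqI) (simp add: coeff_map_poly coeff_mult of_rat_sum of_rat_mult)

lemma of_rat_poly_eq_iff:
  "Polynomial.map_poly (of_rat :: rat \<Rightarrow> complex) p = Polynomial.map_poly of_rat q \<longleftrightarrow> p = q"
  by (auto simp: poly_eq_iff coeff_map_poly)

lemma poly_over_Rats_E:
  assumes "P \<in> poly_over \<rat>"
  obtains p where "P = Polynomial.map_poly of_rat p"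
  using assms ratpolyE[of P] by (auto simp: poly_over_def)

lemma of_int_poly_in_poly_over: "Polynomial.map_poly of_int f \<in> poly_over \<rat>"
  by (auto simp: poly_over_def coeff_map_poly)

lemma degree_of_int_poly:
  "Polynomial.degree (Polynomial.map_poly (of_int :: int \<Rightarrow> complex) f) = Polynomial.degree f"
  by (rule degree_map_poly) simp

text \<open>
  A minimal polynomial of the root divides \<open>f\<close> over \<open>\<rat>\<close>, so by irreducibility it has the degree of \<open>f\<close>.
\<close>

lemma irreducible_root_degree:
  assumes irr: "irreducible_over_rat f" and x: "x \<in> complex_roots f"
    and g: "poly (Polynomial.map_poly of_int g) x = 0" "Polynomial.degree g < Polynomial.degree f"
  shows "g = 0"
proof (rule ccontr)
  interpret Q: complex_subfield \<rat> by (rule complex_subfield_Rats)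
  assume "g \<noteq> 0"
  define F where "F = (Polynomial.map_poly of_int f :: rat poly)"
  have F: "Polynomial.map_poly of_int f = (Polynomial.map_poly of_rat F :: complex poly)"
    unfolding F_def by (intro poly_eqI) (simp add: coeff_map_poly)
  have irrF: "Factorial_Ring.irreducible F"
    using irr by (simp add: irreducible_over_rat_def F_def)
  have "F \<noteq> 0" using irrF by auto
  have root: "poly (Polynomial.map_poly of_int f) x = 0"
    using x by (simp add: complex_roots_def)
  have "Polynomial.map_poly (of_int :: int \<Rightarrow> complex) f \<noteq> 0"
    unfolding F using \<open>F \<noteq> 0\<close> of_rat_poly_eq_iff[of F 0] by simp
  then obtain M where M: "min_poly_over \<rat> x M"
    using min_poly_over_exists[OF of_int_poly_in_poly_over _ root] by blast
  obtain S where S: "S \<in> poly_over \<rat>" "Polynomial.map_poly of_int f = S * M"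
    using Q.min_poly_divides[OF M of_int_poly_in_poly_over root] .
  obtain s m where sm: "S = Polynomial.map_poly of_rat s" "M = Polynomial.map_poly of_rat m"
    using S(1) M poly_over_Rats_E unfolding min_poly_over_def by metis
  have "F = s * m" using S(2) unfolding F sm by (simp add: of_rat_poly_mult[symmetric] of_rat_poly_eq_iff)
  moreover have "Polynomial.degree m > 0"
    using Q.min_poly_degree_pos[OF M] unfolding sm by (simp add: degree_map_poly)
  ultimately have "is_unit s"
    using irrF \<open>F \<noteq> 0\<close> by (metis Factorial_Ring.irreducibleD is_unit_iff_degree less_irrefl mult_zero_right)
  then have "Polynomial.degree s = 0" by (metis is_unit_iff_degree not_is_unit_0)
  have "Polynomial.degree f = Polynomial.degree (S * M)"
    unfolding S(2)[symmetric] by (simp add: degree_of_int_poly)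
  also have "\<dots> \<le> Polynomial.degree S + Polynomial.degree M" by (rule degree_mult_le)
  also have "\<dots> = Polynomial.degree M"
    using \<open>Polynomial.degree s = 0\<close> by (simp add: sm(1) degree_map_poly)
  also have "\<dots> \<le> Polynomial.degree g"
  proof -
    have "Polynomial.map_poly (of_int :: int \<Rightarrow> complex) g \<noteq> 0"
      using \<open>g \<noteq> 0\<close> by (subst map_poly_eq_0_iff) auto
    then show ?thesis
      using M g(1) of_int_poly_in_poly_over[of g] degree_of_int_poly[of g] unfolding min_poly_over_def by metis
  qed
  finally show False using g(2) by simp
qed

text \<open>
  The elements fixed by \<open>\<phi>\<close> form a subfield.
\<close>

lemma rat_automorphism_fixing_generators:
  assumes \<phi>: "\<phi> \<in> rat_automorphisms (adjoin_rat S)" and S: "\<And>s. s \<in> S \<Longrightarrow> \<phi> s = s"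
    and x: "x \<in> adjoin_rat S"
  shows "\<phi> x = x"
proof -
  let ?L = "adjoin_rat S"
  interpret L: complex_subfield ?L by (rule complex_subfield_adjoin_rat)
  note D = rat_automorphismsD[OF \<phi>]
  have "complex_subfield {x \<in> ?L. \<phi> x = x}"
  proof
    show "1 \<in> {x \<in> ?L. \<phi> x = x}" using D(6)[of 1] by (simp add: L.one_mem)
    fix x assume x: "x \<in> {x \<in> ?L. \<phi> x = x}"
    show "- x \<in> {x \<in> ?L. \<phi> x = x}"
      using x D(5)[of "- 1" x] D(6)[of "- 1"] by (simp add: L.one_mem L.uminus_mem)
    show "inverse x \<in> {x \<in> ?L. \<phi> x = x}" if "x \<noteq> 0"
    proof -
      have "x * \<phi> (inverse x) = 1"
        using D(5)[of x "inverse x"] x that D(6)[of 1] by (simp add: L.inverse_mem)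
      then have "\<phi> (inverse x) = inverse x" by (rule inverse_unique[symmetric])
      then show ?thesis using x that by (simp add: L.inverse_mem)
    qed
    fix y assume y: "y \<in> {x \<in> ?L. \<phi> x = x}"
    show "x + y \<in> {x \<in> ?L. \<phi> x = x}" using x y by (simp add: L.add_mem D(4))
    show "x * y \<in> {x \<in> ?L. \<phi> x = x}" using x y by (simp add: L.mult_mem D(5))
  qed
  moreover have "S \<subseteq> {x \<in> ?L. \<phi> x = x}" using S by (auto intro: adjoin_rat_incl)
  ultimately show ?thesis using adjoin_rat_minimal x by blast
qed

lemma rat_automorphisms_compose:
  assumes "\<phi> \<in> rat_automorphisms L" "\<psi> \<in> rat_automorphisms L" "complex_subfield L"
  shows "compose L \<phi> \<psi> \<in> rat_automorphisms L"
proof -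
  interpret complex_subfield L by fact
  note D = rat_automorphismsD[OF assms(1)] and E = rat_automorphismsD[OF assms(2)]
  show ?thesis
    using Rats_subset
    by (intro rat_automorphismsI compose_extensional bij_betw_compose[OF E(2) D(2)])
      (auto simp: compose_def D E add_mem mult_mem)
qed

text \<open>
  The generator is the preimage of 1 under an isomorphism \<open>\<Phi>\<close>, and the restriction of its \<open>k\<close>-fold iterate
  is then the preimage of \<open>k\<close>. The restriction is necessary because automorphisms are \<open>undefined\<close> outside
  the splitting field, whereas the zeroth iterate is the identity everywhere.
\<close>

lemma cyclic_Galois_generator:
  assumes iso: "Galois_group f \<cong> integer_mod_group n" and n: "n > 0"
  obtains \<sigma> where "\<sigma> \<in> rat_automorphisms (splitting_field f)"
    "\<And>k. restrict (\<sigma> ^^ k) (splitting_field f) \<in> rat_automorphisms (splitting_field f)"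
    "\<And>\<phi>. \<phi> \<in> rat_automorphisms (splitting_field f) \<Longrightarrow> \<exists>k. \<phi> = restrict (\<sigma> ^^ k) (splitting_field f)"
    "\<And>k. (\<forall>x \<in> splitting_field f. (\<sigma> ^^ k) x = x) \<longleftrightarrow> n dvd k"
proof -
  let ?L = "splitting_field f" let ?A = "rat_automorphisms ?L"
  interpret L: complex_subfield ?L unfolding splitting_field_def by (rule complex_subfield_adjoin_rat)
  obtain \<Phi> where bij: "bij_betw \<Phi> ?A {0..<int n}"
    and hom: "\<And>\<phi> \<psi>. \<phi> \<in> ?A \<Longrightarrow> \<psi> \<in> ?A \<Longrightarrow> \<Phi> (compose ?L \<phi> \<psi>) = (\<Phi> \<phi> + \<Phi> \<psi>) mod int n"
  proof -
    obtain \<Phi> where \<Phi>: "\<Phi> \<in> iso (Galois_group f) (integer_mod_group n)"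
      using iso by (auto simp: is_iso_def)
    show ?thesis
    proof
      show "bij_betw \<Phi> ?A {0..<int n}"
        using \<Phi> n by (auto simp: iso_def Galois_group_def carrier_integer_mod_group)
      fix \<phi> \<psi> assume "\<phi> \<in> ?A" "\<psi> \<in> ?A"
      moreover from this have "\<phi> \<in> Bij ?L" "\<psi> \<in> Bij ?L" by (auto dest: rat_automorphismsD)
      moreover from this have "\<phi> \<otimes>\<^bsub>Galois_group f\<^esub> \<psi> = compose ?L \<phi> \<psi>"
        by (simp add: Galois_group_def BijGroup_def)
      moreover have "carrier (Galois_group f) = ?A" by (simp add: Galois_group_def)
      ultimately show "\<Phi> (compose ?L \<phi> \<psi>) = (\<Phi> \<phi> + \<Phi> \<psi>) mod int n"
        using \<Phi> hom_mult[of \<Phi> "Galois_group f" "integer_mod_group n" \<phi> \<psi>] by (auto simp: iso_def)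
    qed
  qed
  define \<sigma> where "\<sigma> = inv_into ?A \<Phi> (1 mod int n)"
  have "1 mod int n \<in> {0..<int n}" using n by simp
  then have \<sigma>: "\<sigma> \<in> ?A" "\<Phi> \<sigma> = 1 mod int n"
    using bij_betw_inv_into_right[OF bij] inv_into_into[of "1 mod int n" \<Phi> ?A] bij
    by (auto simp: \<sigma>_def bij_betw_def)
  have id: "(\<lambda>x\<in>?L. x) \<in> ?A"
    using L.Rats_subset by (intro rat_automorphismsI) (auto simp: L.add_mem L.mult_mem bij_betw_def inj_on_def)
  define e where "e = \<Phi> (\<lambda>x\<in>?L. x)"
  have "compose ?L (\<lambda>x\<in>?L. x) (\<lambda>x\<in>?L. x) = (\<lambda>x\<in>?L. x)"
    by (auto simp: compose_def)
  then have "e = (e + e) mod int n" using hom[OF id id] by (simp add: e_def)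
  moreover have e: "0 \<le> e" "e < int n" using bij id by (auto simp: e_def dest: bij_betwE)
  ultimately have "int n dvd e" by (metis add_diff_cancel_right' mod_eq_dvd_iff mod_pos_pos_trivial)
  then have "e = 0" using e by (metis dvd_imp_mod_0 mod_pos_pos_trivial)
  then have id0: "\<Phi> (\<lambda>x\<in>?L. x) = 0" by (simp add: e_def)
  have pow: "restrict (\<sigma> ^^ k) ?L \<in> ?A \<and> \<Phi> (restrict (\<sigma> ^^ k) ?L) = int k mod int n" for k
  proof (induction k)
    case 0
    then show ?case using id id0 by (simp add: restrict_def)
  next
    case (Suc k)
    have eq: "restrict (\<sigma> ^^ Suc k) ?L = compose ?L \<sigma> (restrict (\<sigma> ^^ k) ?L)"
      by (auto simp: compose_def restrict_def)
    let ?\<tau> = "restrict (\<sigma> ^^ k) ?L"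
    have \<tau>: "?\<tau> \<in> ?A" "\<Phi> ?\<tau> = int k mod int n" using Suc by blast+
    show ?case
    proof
      show "restrict (\<sigma> ^^ Suc k) ?L \<in> ?A"
        unfolding eq
        by (rule rat_automorphisms_compose[OF \<sigma>(1) \<tau>(1) L.complex_subfield_axioms])
      show "\<Phi> (restrict (\<sigma> ^^ Suc k) ?L) = int (Suc k) mod int n"
        unfolding eq hom[OF \<sigma>(1) \<tau>(1)] \<sigma>(2) \<tau>(2) by (simp add: mod_simps)
    qed
  qed
  show ?thesis
  proof
    show "\<sigma> \<in> ?A" by fact
    show "restrict (\<sigma> ^^ k) ?L \<in> ?A" for k using pow by simp
    fix \<phi> assume \<phi>: "\<phi> \<in> ?A"
    then have range: "\<Phi> \<phi> \<in> {0..<int n}" using bij by (auto dest: bij_betwE)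
    then have "\<Phi> \<phi> = \<Phi> (restrict (\<sigma> ^^ nat (\<Phi> \<phi>)) ?L)" using pow by simp
    then have "\<phi> = restrict (\<sigma> ^^ nat (\<Phi> \<phi>)) ?L"
      using inj_onD[OF bij_betw_imp_inj_on[OF bij]] \<phi> pow by blast
    then show "\<exists>k. \<phi> = restrict (\<sigma> ^^ k) ?L" ..
  next
    fix k
    have "(\<forall>x \<in> ?L. (\<sigma> ^^ k) x = x) \<longleftrightarrow> restrict (\<sigma> ^^ k) ?L = (\<lambda>x\<in>?L. x)"
      by (auto simp: fun_eq_iff restrict_def)
    also have "\<dots> \<longleftrightarrow> \<Phi> (restrict (\<sigma> ^^ k) ?L) = \<Phi> (\<lambda>x\<in>?L. x)"
      using inj_on_eq_iff[OF bij_betw_imp_inj_on[OF bij] conjunct1[OF pow] id] by simp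
    also have "\<dots> \<longleftrightarrow> int n dvd int k" using pow id0 by (simp add: dvd_eq_mod_eq_0)
    finally show "(\<forall>x \<in> ?L. (\<sigma> ^^ k) x = x) \<longleftrightarrow> n dvd k" by simp
  qed
qed

section \<open>The roots of a cyclic quartic trinomial\<close>

text \<open>
  These are Vieta's formulas, solved for \<open>w\<close>, \<open>y w\<close>, \<open>c\<close> and \<open>d\<close>. Repeated divided differences of the
  equation for the roots give them directly.
\<close>

lemma depressed_quartic_roots:
  fixes x y z w c d :: complex
  assumes dist: "distinct [x, y, z, w]"
    and root: "\<And>v. v \<in> {x, y, z, w} \<Longrightarrow> v ^ 4 + c * v + d = 0"
  shows "w = - (x + y + z)" "y * w = x\<^sup>2 + x * z + z\<^sup>2" "c = - ((x + z) * (x\<^sup>2 + z\<^sup>2))"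
    "d = x * z * (x\<^sup>2 + x * z + z\<^sup>2)"
proof -
  have lin: "c = - ((u + v) * (u\<^sup>2 + v\<^sup>2))" if "u \<noteq> v" "u \<in> {x, y, z, w}" "v \<in> {x, y, z, w}" for u v
  proof -
    have "(u - v) * ((u + v) * (u\<^sup>2 + v\<^sup>2) + c) = (u ^ 4 + c * u + d) - (v ^ 4 + c * v + d)"
      by (simp add: algebra_simps power2_eq_square power4_eq_xxxx)
    also have "\<dots> = 0" using root that by simp
    finally show ?thesis using that(1) by (simp add: add_eq_0_iff)
  qed
  have quad: "u\<^sup>2 + v\<^sup>2 + t\<^sup>2 + u * v + v * t + u * t = 0"
    if "distinct [u, v, t]" "u \<in> {x, y, z, w}" "v \<in> {x, y, z, w}" "t \<in> {x, y, z, w}" for u v t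
  proof -
    have "(v - t) * (u\<^sup>2 + v\<^sup>2 + t\<^sup>2 + u * v + v * t + u * t) = (u + v) * (u\<^sup>2 + v\<^sup>2) - (u + t) * (u\<^sup>2 + t\<^sup>2)"
      by (simp add: algebra_simps power2_eq_square)
    also have "\<dots> = 0" using lin[of u v] lin[of u t] that by simp
    finally show ?thesis using that(1) by simp
  qed
  have "(z - w) * (x + y + z + w) = (x\<^sup>2 + y\<^sup>2 + z\<^sup>2 + x * y + y * z + x * z) - (x\<^sup>2 + y\<^sup>2 + w\<^sup>2 + x * y + y * w + x * w)"
    by (simp add: algebra_simps power2_eq_square)
  also have "\<dots> = 0" using quad[of x y z] quad[of x y w] dist by simp
  finally show w: "w = - (x + y + z)" using dist by (simp add: add_eq_0_iff)
  have quad0: "x\<^sup>2 + y\<^sup>2 + z\<^sup>2 + x * y + y * z + x * z = 0"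
    using quad[of x y z] dist by simp
  have "y * w = (x\<^sup>2 + x * z + z\<^sup>2) - (x\<^sup>2 + y\<^sup>2 + z\<^sup>2 + x * y + y * z + x * z)"
    unfolding w by (simp add: algebra_simps power2_eq_square)
  then show "y * w = x\<^sup>2 + x * z + z\<^sup>2" unfolding quad0 by simp
  show c: "c = - ((x + z) * (x\<^sup>2 + z\<^sup>2))" using lin[of x z] dist by simp
  show "d = x * z * (x\<^sup>2 + x * z + z\<^sup>2)" using root[of x] unfolding c
    by (simp add: add_eq_0_iff algebra_simps power2_eq_square power4_eq_xxxx)
qed

text \<open>
  The integer \<open>m\<close> will be the coefficient of \<open>x\<^sup>3\<close> in the representation of \<open>s\<close>. By the resolvent equation
  \<open>B = 3 t\<^sup>2 - 4 d\<close> satisfies \<open>B t = 2 t\<^sup>3 + c\<^sup>2\<close>, which is too large for \<open>B\<close> to divide \<open>4 t\<close> unless \<open>t = 1\<close>.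
\<close>

lemma no_integral_cubic_coefficient:
  fixes t c d m :: int
  assumes c: "c \<noteq> 0" and t: "t > 0" and resolvent: "t ^ 3 - 4 * d * t = c\<^sup>2"
    and dvd: "(3 * t\<^sup>2 - 4 * d) * m = - 4 * t"
  shows False
proof -
  define B where "B = 3 * t\<^sup>2 - 4 * d"
  have Bt: "B * t = 2 * t ^ 3 + c\<^sup>2" using resolvent unfolding B_def
    by (simp add: algebra_simps power2_eq_square power3_eq_cube)
  have c1: "c\<^sup>2 \<ge> 1" using c by (smt (verit) zero_less_power2)
  have "B * t > 0" unfolding Bt using t c1 by (smt (verit) zero_less_power)
  then have B: "B > 0" using t by (simp add: zero_less_mult_iff)
  have "B dvd 4 * t" using dvd unfolding B_def[symmetric] by (metis dvd_triv_left dvd_minus_iff mult_minus_left)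
  then have "B \<le> 4 * t" using t by (simp add: zdvd_imp_le)
  then have "B * t \<le> 4 * t * t" using t by (simp add: mult_right_mono)
  then have le: "2 * t ^ 3 + c\<^sup>2 \<le> 4 * t\<^sup>2" unfolding Bt by (simp add: power2_eq_square)
  have "t = 1"
  proof (rule ccontr)
    assume "t \<noteq> 1"
    then have "t \<ge> 2" using t by simp
    then have "2 * t\<^sup>2 \<le> t * t\<^sup>2" by (intro mult_right_mono) auto
    then show False using le c1 by (simp add: power3_eq_cube power2_eq_square)
  qed
  then have "c\<^sup>2 \<le> 2" "B = 2 + c\<^sup>2" using le Bt by simp_all
  moreover have "\<bar>c\<bar> < 2"
  proof (rule ccontr)
    assume "\<not> \<bar>c\<bar> < 2"
    then have "2\<^sup>2 \<le> \<bar>c\<bar>\<^sup>2" by (intro power_mono) auto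
    then show False using \<open>c\<^sup>2 \<le> 2\<close> by simp
  qed
  then have "c = 1 \<or> c = - 1" using c by arith
  ultimately have "B = 3" by auto
  then show False using \<open>B dvd 4 * t\<close> \<open>t = 1\<close> by simp
qed

lemma rat_automorphism_sends_root:
  assumes \<phi>: "\<phi> \<in> rat_automorphisms (splitting_field f)" and z: "z \<in> complex_roots f"
  shows "\<phi> z \<in> complex_roots f"
proof -
  interpret L: complex_subfield "splitting_field f"
    unfolding splitting_field_def by (rule complex_subfield_adjoin_rat)
  note D = rat_automorphismsD[OF \<phi>]
  have zL: "z \<in> splitting_field f"
    using z by (simp add: splitting_field_def adjoin_rat_incl)
  have power: "\<phi> (z ^ n) = \<phi> z ^ n" for n
    by (induction n) (use D(6)[of 1] in \<open>simp_all add: D(5) zL L.power_mem\<close>)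
  have sum: "\<phi> (\<Sum>i\<in>I. g i) = (\<Sum>i\<in>I. \<phi> (g i))" if "\<And>i. i \<in> I \<Longrightarrow> g i \<in> splitting_field f"
    for g and I :: "nat set"
    using that by (induction I rule: infinite_finite_induct)
      (use D(6)[of 0] in \<open>simp_all add: D(4) L.sum_mem\<close>)
  have coeff: "Polynomial.coeff (Polynomial.map_poly of_int f) i \<in> \<rat>" for i
    by (simp add: coeff_map_poly)
  then have coeff_L: "Polynomial.coeff (Polynomial.map_poly of_int f) i \<in> splitting_field f" for i
    using L.Rats_subset by blast
  have "\<phi> (poly (Polynomial.map_poly of_int f) z) = poly (Polynomial.map_poly of_int f) (\<phi> z)"
    unfolding poly_altdef
    by (simp add: sum D(5) D(6)[OF coeff] coeff_L L.mult_mem L.power_mem zL power)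
  then show ?thesis using z D(6)[of 0] by (simp add: complex_roots_def)
qed

text \<open>
  The polynomial form makes it possible to compare coefficients through irreducibility, without discussing
  whether the powers of \<open>x\<close> are distinct.
\<close>

lemma int_span_powers:
  assumes "z \<in> int_module.span ((\<lambda>i. x ^ i) ` {..<n})" and n: "n > 0"
  obtains g where "Polynomial.degree g < n" "z = poly (Polynomial.map_poly of_int g) x"
proof -
  define W where "W = {poly (Polynomial.map_poly of_int g) x | g. Polynomial.degree g < n}"
  have hom: "Polynomial.map_poly of_int (g + h) = (Polynomial.map_poly of_int g + Polynomial.map_poly of_int h :: complex poly)"
    "Polynomial.map_poly of_int (Polynomial.smult k g) = Polynomial.smult (of_int k) (Polynomial.map_poly of_int g :: complex poly)"
    for g h k by (auto intro!: poly_eqI simp: coeff_map_poly)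
  have "int_module.subspace W"
  proof (intro int_module.subspaceI)
    show "0 \<in> W" unfolding W_def using n by (auto intro!: exI[of _ 0])
    show "u + v \<in> W" if "u \<in> W" "v \<in> W" for u v
      using that unfolding W_def
      by (auto simp: hom(1)[symmetric] poly_add[symmetric] simp del: poly_add intro: degree_add_less)
    show "of_int k * u \<in> W" if u: "u \<in> W" for k u
    proof -
      obtain g where g: "Polynomial.degree g < n" "u = poly (Polynomial.map_poly of_int g) x"
        using u by (auto simp: W_def)
      have "of_int k * u = poly (Polynomial.map_poly of_int (Polynomial.smult k g)) x"
        by (simp add: hom g(2))
      moreover have "Polynomial.degree (Polynomial.smult k g) < n"
        using g(1) degree_smult_le[of k g] by simp
      ultimately show ?thesis unfolding W_def by blast
    qed
  qed
  moreover have "(\<lambda>i. x ^ i) ` {..<n} \<subseteq> W"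
  proof safe
    fix i assume "i < n"
    then show "x ^ i \<in> W" unfolding W_def
      by (intro CollectI exI[of _ "Polynomial.monom 1 i"]) (simp add: map_poly_monom poly_monom degree_monom_eq)
  qed
  ultimately have "z \<in> W" using assms(1) int_module.span_minimal by blast
  then show ?thesis using that by (auto simp: W_def)
qed

lemma four_cycle_distinct:
  assumes inj: "inj_on \<sigma> L" and L: "\<And>x. x \<in> L \<Longrightarrow> \<sigma> x \<in> L" and x: "x \<in> L"
    and four: "\<sigma> (\<sigma> (\<sigma> (\<sigma> x))) = x" and two: "\<sigma> (\<sigma> x) \<noteq> x"
  shows "distinct [x, \<sigma> x, \<sigma> (\<sigma> x), \<sigma> (\<sigma> (\<sigma> x))]"
proof -
  have eq: "\<sigma> u = \<sigma> v \<longleftrightarrow> u = v" if "u \<in> L" "v \<in> L" for u v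
    using inj that by (auto simp: inj_on_def)
  have "\<sigma> x \<noteq> x" using two by auto
  moreover have "\<sigma> (\<sigma> (\<sigma> x)) \<noteq> x" using four two by auto
  moreover have "\<sigma> (\<sigma> (\<sigma> x)) \<noteq> \<sigma> x" using two by (simp add: eq L x)
  ultimately show ?thesis using two by (auto simp: eq L x)
qed

text \<open>
  The square of the generator is not the identity on \<open>L\<close>, and \<open>L\<close> is generated by the roots, so the square
  moves some root \<open>a\<close>. The orbit of \<open>a\<close> has four elements, hence consists of all roots; in particular it
  contains \<open>x\<close>. An element fixed by the generator is fixed by the whole group, hence rational.
\<close>

lemma cyclic_quartic_root_cycle:
  assumes deg: "Polynomial.degree f = 4" and cyc: "cyclic_poly f" and x: "x \<in> complex_roots f"
  obtains \<sigma> where "\<sigma> \<in> rat_automorphisms (splitting_field f)"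
    "distinct [x, \<sigma> x, \<sigma> (\<sigma> x), \<sigma> (\<sigma> (\<sigma> x))]" "\<sigma> (\<sigma> (\<sigma> (\<sigma> x))) = x"
    "\<And>u. u \<in> splitting_field f \<Longrightarrow> \<sigma> u = u \<Longrightarrow> u \<in> \<rat>"
proof -
  let ?L = "splitting_field f"
  let ?F = "Polynomial.map_poly of_int f :: complex poly"
  have "Galois_group f \<cong> integer_mod_group 4" using cyc deg by (simp add: cyclic_poly_def)
  then obtain \<sigma> where \<sigma>: "\<sigma> \<in> rat_automorphisms ?L"
    "\<And>k. restrict (\<sigma> ^^ k) ?L \<in> rat_automorphisms ?L"
    "\<And>\<phi>. \<phi> \<in> rat_automorphisms ?L \<Longrightarrow> \<exists>k. \<phi> = restrict (\<sigma> ^^ k) ?L"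
    "\<And>k. (\<forall>x \<in> ?L. (\<sigma> ^^ k) x = x) \<longleftrightarrow> 4 dvd k"
    using cyclic_Galois_generator[of f 4] by (metis zero_less_numeral)
  note D = rat_automorphismsD[OF \<sigma>(1)]
  have inj: "inj_on \<sigma> ?L" using D(2) by (simp add: bij_betw_def)
  have roots_L: "z \<in> ?L" if "z \<in> complex_roots f" for z
    using that by (simp add: splitting_field_def adjoin_rat_incl)
  note roots_\<sigma> = rat_automorphism_sends_root[OF \<sigma>(1)]
  have F0: "?F \<noteq> 0" using deg degree_of_int_poly[of f] by auto
  have four: "\<sigma> (\<sigma> (\<sigma> (\<sigma> z))) = z" if "z \<in> ?L" for z
    using \<sigma>(4)[of 4] that by (simp add: numeral_eq_Suc)
  have "\<exists>a \<in> complex_roots f. \<sigma> (\<sigma> a) \<noteq> a"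
  proof (rule ccontr)
    assume "\<not> ?thesis"
    then have fix_roots: "restrict (\<sigma> ^^ 2) ?L a = a" if "a \<in> complex_roots f" for a
      using that roots_L by (simp add: numeral_2_eq_2)
    have "\<forall>z \<in> ?L. (\<sigma> ^^ 2) z = z"
    proof
      fix z assume z: "z \<in> ?L"
      then have "restrict (\<sigma> ^^ 2) ?L z = z"
        using rat_automorphism_fixing_generators[OF _ fix_roots, of "complex_roots f"] \<sigma>(2)[of 2]
        by (simp only: splitting_field_def)
      then show "(\<sigma> ^^ 2) z = z" using z by simp
    qed
    then show False using \<sigma>(4)[of 2] by simp
  qed
  then obtain a where a: "a \<in> complex_roots f" "\<sigma> (\<sigma> a) \<noteq> a" by blast
  define A where "A = {a, \<sigma> a, \<sigma> (\<sigma> a), \<sigma> (\<sigma> (\<sigma> a))}"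
  have dist: "distinct [a, \<sigma> a, \<sigma> (\<sigma> a), \<sigma> (\<sigma> (\<sigma> a))]"
    using four_cycle_distinct[OF inj D(7) roots_L[OF a(1)] four[OF roots_L[OF a(1)]] a(2)] .
  then have "card A = 4" by (simp add: A_def)
  moreover have "card (complex_roots f) \<le> 4"
    using card_poly_roots_bound[OF F0] deg by (simp add: complex_roots_def degree_of_int_poly)
  moreover have "A \<subseteq> complex_roots f" using a roots_\<sigma> by (auto simp: A_def)
  moreover have "finite (complex_roots f)" using F0 by (simp add: complex_roots_def poly_roots_finite)
  ultimately have "complex_roots f = A" by (metis card_seteq)
  then have "\<sigma> (\<sigma> x) \<noteq> x"
    using x dist four[OF roots_L[OF a(1)]] by (auto simp: A_def)
  then have "distinct [x, \<sigma> x, \<sigma> (\<sigma> x), \<sigma> (\<sigma> (\<sigma> x))]"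
    using four_cycle_distinct[OF inj D(7) roots_L[OF x] four[OF roots_L[OF x]]] by simp
  moreover have "u \<in> \<rat>" if u: "u \<in> ?L" "\<sigma> u = u" for u
  proof -
    have L: "?L = adjoin_rat {z. poly ?F z = 0}" by (simp add: splitting_field_def complex_roots_def)
    have "(\<sigma> ^^ k) u = u" for k by (induction k) (simp_all add: u(2))
    then have "\<phi> u = u" if "\<phi> \<in> rat_automorphisms ?L" for \<phi>
      using \<sigma>(3)[OF that] u(1) by auto
    then show ?thesis
      using fixed_field_rational[OF of_int_poly_in_poly_over F0, of u] u(1) unfolding L by blast
  qed
  ultimately show ?thesis using that \<sigma>(1) four roots_L[OF x] by blast
qed

lemma poly_of_int_cubic:
  "poly (Polynomial.map_poly of_int [:a0, a1, a2, a3:]) x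
     = of_int a0 + of_int a1 * x + of_int a2 * x\<^sup>2 + (of_int a3 * x ^ 3 :: complex)"
  by (simp add: map_poly_pCons distrib_left power2_eq_square power3_eq_cube mult_ac)

text \<open>
  With \<open>z = s - x\<close> and \<open>p = x z\<close>, the expressions for \<open>c\<close> and \<open>d\<close> are those that Vieta's formulas give. The
  formula inverts \<open>s (2 t x - c) = 2 t x\<^sup>2 + t\<^sup>2\<close>, a consequence of \<open>x\<^sup>2 - s x + p = 0\<close>, in \<open>\<rat>(x)\<close>. Once
  found, it is a polynomial identity in \<open>x\<close> and \<open>s\<close>.
\<close>

lemma pair_sum_in_powers:
  fixes x s p t c d :: complex
  assumes p: "p = x * (s - x)" and t: "t = s\<^sup>2" and c: "c = s * (2 * p - s\<^sup>2)" and d: "d = p * (s\<^sup>2 - p)"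
  shows "(3 * t\<^sup>2 - 4 * d) * s = - 3 * t * c + 2 * t\<^sup>2 * x - 2 * c * x\<^sup>2 - 4 * t * x ^ 3"
  unfolding t c d p by (simp add: algebra_simps power2_eq_square power3_eq_cube)

theorem theorem1p1:
  shows "\<not> (\<exists>(c::int) (d::int). c * d \<noteq> 0 \<and>
            (let f = Polynomial.monom 1 4 + Polynomial.monom c 1 + Polynomial.monom d 0
             in monogenic f \<and> cyclic_poly f))"
proof
  assume "\<exists>(c::int) (d::int). c * d \<noteq> 0 \<and>
            (let f = Polynomial.monom 1 4 + Polynomial.monom c 1 + Polynomial.monom d 0
             in monogenic f \<and> cyclic_poly f)"
  then obtain c d f where c: "c \<noteq> 0"
    and f: "f = Polynomial.monom 1 4 + Polynomial.monom c 1 + Polynomial.monom d 0"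
    and mono: "monogenic f" and cyc: "cyclic_poly f"
    by (auto simp: Let_def)
  have "f = [:d, c, 0, 0, 1:]"
    unfolding f by (simp add: monom_altdef numeral_eq_Suc)
  then have deg: "Polynomial.degree f = 4" and
    eval: "poly (Polynomial.map_poly of_int f) z = z ^ 4 + of_int c * z + of_int d" for z :: complex
    by (simp_all add: map_poly_pCons algebra_simps numeral_eq_Suc)
  obtain x where x: "x \<in> complex_roots f"
    and basis: "int_basis ((\<lambda>i. x ^ i) ` {..<4}) (ring_of_integers (adjoin_rat {x}))"
    and irr: "irreducible_over_rat f"
    using mono by (auto simp: monogenic_def deg)
  obtain \<sigma> where \<sigma>: "\<sigma> \<in> rat_automorphisms (splitting_field f)"
    and dist: "distinct [x, \<sigma> x, \<sigma> (\<sigma> x), \<sigma> (\<sigma> (\<sigma> x))]" and four: "\<sigma> (\<sigma> (\<sigma> (\<sigma> x))) = x"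
    and fixed: "\<And>u. u \<in> splitting_field f \<Longrightarrow> \<sigma> u = u \<Longrightarrow> u \<in> \<rat>"
    using cyclic_quartic_root_cycle[OF deg cyc x] by blast
  note D = rat_automorphismsD[OF \<sigma>]
  interpret L: complex_subfield "splitting_field f"
    unfolding splitting_field_def by (rule complex_subfield_adjoin_rat)
  define y z w where "y = \<sigma> x" and "z = \<sigma> y" and "w = \<sigma> z"
  have \<sigma>_roots: "\<sigma> x = y" "\<sigma> y = z" "\<sigma> z = w" "\<sigma> w = x"
    using four by (simp_all add: y_def z_def w_def)
  have roots: "x \<in> complex_roots f" "y \<in> complex_roots f" "z \<in> complex_roots f" "w \<in> complex_roots f"
    using x rat_automorphism_sends_root[OF \<sigma>] by (simp_all add: y_def z_def w_def)
  then have in_L: "x \<in> splitting_field f" "y \<in> splitting_field f" "z \<in> splitting_field f" "w \<in> splitting_field f"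
    by (simp_all add: splitting_field_def adjoin_rat_incl)
  have "v ^ 4 + of_int c * v + of_int d = 0" if "v \<in> {x, y, z, w}" for v
    using roots that by (auto simp: complex_roots_def eval)
  note vieta = depressed_quartic_roots[OF dist[folded y_def, folded z_def, folded w_def] this]
  define s where "s = x + z"
  define p where "p = x * z"
  have vieta': "y + w = - s" "y * w = s\<^sup>2 - p" "of_int c = s * (2 * p - s\<^sup>2)" "of_int d = p * (s\<^sup>2 - p)"
    using vieta unfolding s_def p_def by (simp_all add: power2_eq_square algebra_simps)
  have resolvent: "(s\<^sup>2) ^ 3 - 4 * of_int d * s\<^sup>2 = (of_int c)\<^sup>2"
    unfolding vieta'
    by (simp add: algebra_simps power2_eq_square power3_eq_cube)
  have neg: "\<sigma> (- u) = - \<sigma> u" if "u \<in> splitting_field f" for u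
    using D(5)[of "- 1" u] D(6)[of "- 1"] that by (simp add: L.one_mem L.uminus_mem)
  have diff: "\<sigma> (u - v) = \<sigma> u - \<sigma> v" if "u \<in> splitting_field f" "v \<in> splitting_field f" for u v
    using D(4)[of u "- v"] neg[of v] that by (simp add: L.uminus_mem)
  note mem = in_L L.add_mem L.mult_mem L.diff_mem
  have s_L: "s \<in> splitting_field f" by (simp add: s_def mem)
  have \<sigma>s: "\<sigma> s = - s" using vieta'(1) by (simp add: s_def D(4) mem \<sigma>_roots)
  have "s * s \<in> \<rat>" using fixed[of "s * s"] by (simp add: D(5) s_L \<sigma>s L.mult_mem)
  then have sq_rat: "s\<^sup>2 \<in> \<rat>" by (simp add: power2_eq_square)
  have sq_int: "algebraic_int (s\<^sup>2)"
  proof (rule algebraic_int.intros)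
    let ?R = "[:- (of_int c)\<^sup>2, - 4 * of_int d, 0, 1:] :: complex poly"
    show "Polynomial.lead_coeff ?R = 1" by simp
    show "\<forall>i. Polynomial.coeff ?R i \<in> \<int>" by (auto simp: coeff_pCons split: nat.split)
    show "poly ?R (s\<^sup>2) = 0"
      using resolvent by (simp add: algebra_simps power2_eq_square power3_eq_cube)
  qed
  then obtain t where t: "s\<^sup>2 = of_int t"
    using rational_algebraic_int_is_int[OF sq_int sq_rat] by (auto elim: Ints_cases)
  have res_t: "t ^ 3 - 4 * d * t = c\<^sup>2"
  proof -
    have "of_int (t ^ 3 - 4 * d * t) = (of_int (c\<^sup>2) :: complex)"
      using resolvent unfolding t by simp
    then show ?thesis by (simp only: of_int_eq_iff)
  qed
  \<comment> \<open>All three factors of \<open>u\<close> are square roots of elements of the quadratic subfield; \<open>\<sigma>\<close> changes the sign of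
    \<open>s\<close>, and the sign picked up by \<open>(x - z) (y - w)\<close> compensates it.\<close>
  define u where "u = s * (x - z) * (y - w)"
  have "\<sigma> u = - s * (y - w) * (z - x)"
    unfolding u_def by (simp add: D(5) diff mem s_L \<sigma>s \<sigma>_roots)
  then have "\<sigma> u = u" by (simp add: u_def algebra_simps)
  then have "u \<in> \<rat>" using fixed[of u] by (simp add: u_def mem s_L)
  then obtain q where q: "u = of_rat q" by (auto elim: Rats_cases)
  have "u\<^sup>2 = s\<^sup>2 * (s\<^sup>2 - 4 * p) * ((y + w)\<^sup>2 - 4 * (y * w))"
    unfolding u_def s_def p_def
    by (simp add: algebra_simps power2_eq_square power3_eq_cube)
  also have "\<dots> = (s\<^sup>2) ^ 3 - 4 * (of_int c)\<^sup>2"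
    unfolding vieta'
    by (simp add: algebra_simps power2_eq_square power3_eq_cube)
  finally have "u\<^sup>2 = of_int (t ^ 3 - 4 * c\<^sup>2)" unfolding t by simp
  then have "(of_rat (q\<^sup>2) :: complex) = of_rat (of_int (t ^ 3 - 4 * c\<^sup>2))"
    unfolding q by (simp only: of_rat_power of_rat_of_int_eq)
  then have "q\<^sup>2 = of_int (t ^ 3 - 4 * c\<^sup>2)" by (simp only: of_rat_eq_iff)
  then have "(0::rat) \<le> of_int (t ^ 3 - 4 * c\<^sup>2)" by (metis zero_le_power2)
  then have "t ^ 3 \<ge> 4 * c\<^sup>2" by (simp only: of_int_0_le_iff diff_ge_0_iff_ge)
  moreover have "c\<^sup>2 > 0" using c by simp
  ultimately have "t ^ 3 > 0" by linarith
  then have t_pos: "t > 0" by (simp add: zero_less_power_eq)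
  \<comment> \<open>Monogenicity turns the representation of \<open>s\<close> in powers of \<open>x\<close> into a divisibility by \<open>B\<close>.\<close>
  define B where "B = 3 * t\<^sup>2 - 4 * d"
  have p_eq: "p = x * (s - x)" by (simp add: s_def p_def)
  have expr: "of_int B * s = of_int (- 3 * t * c) + of_int (2 * t\<^sup>2) * x + of_int (- 2 * c) * x\<^sup>2 + of_int (- 4 * t) * x ^ 3"
    using pair_sum_in_powers[OF p_eq t[symmetric] vieta'(3,4)] by (simp add: B_def)
  have "B * t = 2 * t ^ 3 + c\<^sup>2" using res_t unfolding B_def
    by (simp add: algebra_simps power2_eq_square power3_eq_cube)
  moreover have "2 * t ^ 3 + c\<^sup>2 > 0" using t_pos by (intro add_pos_nonneg) simp_all
  ultimately have B0: "B \<noteq> 0" by auto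
  interpret K: complex_subfield "adjoin_rat {x}" by (rule complex_subfield_adjoin_rat)
  have x_K: "x \<in> adjoin_rat {x}" by (simp add: adjoin_rat_incl)
  have "of_int B * s \<in> adjoin_rat {x}"
    unfolding expr by (intro K.add_mem K.mult_mem K.of_int_mem K.power_mem x_K)
  then have "of_int B * s / of_int B \<in> adjoin_rat {x}" by (intro K.divide_mem K.of_int_mem)
  then have "s \<in> adjoin_rat {x}" using B0 by simp
  moreover have "algebraic_int s"
    by (rule algebraic_int_root[where p = "Polynomial.monom 1 2" and y = "s\<^sup>2"])
      (use sq_int in \<open>auto simp: poly_monom degree_monom_eq\<close>)
  ultimately have "s \<in> int_module.span ((\<lambda>i. x ^ i) ` {..<4})"
    using basis by (simp add: int_basis_def ring_of_integers_def)
  then obtain g where g: "Polynomial.degree g < 4" "s = poly (Polynomial.map_poly of_int g) x"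
    using int_span_powers[of s x 4] by auto
  define h where "h = [:- 3 * t * c, 2 * t\<^sup>2, - 2 * c, - 4 * t:]"
  have hx: "poly (Polynomial.map_poly of_int h) x = of_int B * s"
    unfolding expr h_def by (rule poly_of_int_cubic)
  have map: "Polynomial.map_poly of_int (Polynomial.smult B g - h)
     = (Polynomial.smult (of_int B) (Polynomial.map_poly of_int g) - Polynomial.map_poly of_int h :: complex poly)"
    by (intro poly_eqI) (simp add: coeff_map_poly)
  have "poly (Polynomial.map_poly of_int (Polynomial.smult B g - h)) x = 0"
    unfolding map by (simp add: hx g(2)[symmetric])
  moreover have "Polynomial.degree (Polynomial.smult B g - h) < 4"
    using g(1) by (intro degree_diff_less) (auto simp: h_def intro: le_less_trans[OF degree_smult_le])
  ultimately have "Polynomial.smult B g - h = 0"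
    by (intro irreducible_root_degree[OF irr x]) (simp_all add: deg)
  then have "Polynomial.coeff (Polynomial.smult B g) 3 = Polynomial.coeff h 3" by simp
  then have "B * Polynomial.coeff g 3 = - 4 * t" by (simp add: h_def numeral_3_eq_3)
  then show False
    using no_integral_cubic_coefficient[OF c t_pos res_t] by (simp add: B_def)
qed

end
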